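(* Let $\Omega$, $\widetilde\Omega$, the data $\mu,\mathbf b,\sigma,f$ on $\widetilde\Omega$, the trimmed mesh $\mathcal T_h$ ($h\le h_0$), the virtual spaces $V_E$, $V_h$ and the discrete forms $\mathcal B_h,\mathcal F_h$ be as described in the context, with stabilization forms $s_E$ that are symmetric, bilinear, depend only on the boundary values of their arguments, and satisfy $c_s|v|_{1,E}^2\le s_E(v,v)\le C_s|v|_{1,E}^2$ for all $v\in V_E$ with $\widetilde\Pi_Ev=0$, with $C_s\ge c_s>0$ independent of $E$. Let $u_h\in V_h$ be the solution of $\mathcal B_h(u_h,v_h)=\mathcal F_h(v_h)$ for all $v_h\in V_h$. Then $$|u_h|_{1,\Omega_h}\le\frac{\tilde C_P}{\mu_\star}\,\|f\|_{0,\widetilde\Omega},$$ where $\mu_\star>0$ is the ($h$-independent) constant such that $\mu_\star|v|_{1,\Omega_h}^2\le a_h(v,v)$ for all $v\in V_h$, and $\tilde C_P>0$ is the Poincaré constant of $\widetilde\Omega$, i.e. $\|v\|_{0,\widetilde\Omega}\le\tilde C_P|v|_{1,\widetilde\Omega}$ for all $v\in H^1_0(\widetilde\Omega)$.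
   Context: **Domain and data.** $\Omega\subset\mathbb R^2$ is a bounded Lipschitz domain whose boundary is a union of finitely many arcs of class $C^2$ (with bounded second derivative with respect to arclength), meeting only at break points with angles in $(0,2\pi)$. $\widetilde\Omega\supset\overline\Omega$ is a fixed larger bounded domain; $\delta_0>0$ is a lower bound for the distance between $\partial\Omega$ and $\partial\widetilde\Omega$. The data $\mu,\mathbf b,\sigma,f$ are defined on $\widetilde\Omega$ with $\mu\in W^1_\infty(\widetilde\Omega)$, $\mathbf b\in (L^\infty(\widetilde\Omega))^2$, $\nabla\cdot\mathbf b\in L^\infty(\widetilde\Omega)$, $\sigma\in L^\infty(\widetilde\Omega)$, $f\in L^2(\widetilde\Omega)$, $\mu\ge\mu_0>0$ and $\sigma-\frac12\nabla\cdot\mathbf b\ge0$ a.e. **Meshes.** A background mesh $\mathcal T_h^B$ is a conforming tessellation of $\mathbb R^2$ into convex polygons $K$ with, for a universal $\lambda\in(0,1)$: $\lambda h\le h_K\le\lambda^{-1}h$ ($h_K=\mathrm{diam}\,K$), $K$ star-shaped with respect to a ball of diameter $\ge\lambda h_K$, and every edge of length $\ge\lambda h_K$. $\mathcal T_h^B(\Omega)$ is the set of those $K$ with at least one vertex in $\Omega$. The bound $h_0\le\lambda\delta_0$ is such that for some $R>1$ and all $h\le h_0$ there is at most one break point in the $Rh$-neighborhood of each $K\in\mathcal T_h^B(\Omega)$. For $K\in\mathcal T^B_h(\Omega)$, $E_K$ is the convex hull of the vertices of $K$ lying in $\Omega$ together with the points of $\partial\Omega$ lying on those edges of $K$ that have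 at least one endpoint in $\Omega$. $\mathcal T_h=\{E_K:K\in\mathcal T_h^B(\Omega)\}$, $\Omega_h=\mathrm{interior}\bigcup_{E\in\mathcal T_h}E\subset\widetilde\Omega$. **VEM spaces.** $B_{\partial E}$ is the space of continuous functions on $\partial E$ affine on each edge of $E$. $\Pi^\nabla_E:H^1(E)\to\mathbb P_1(E)$ is defined by $(\nabla(v-\Pi^\nabla_Ev),\nabla q)_E=0$ for all $q\in\mathbb P_1(E)$ and $\int_{\partial E}(v-\Pi^\nabla_Ev)=0$. $V_E=\{v\in H^1(E):v_{|\partial E}\in B_{\partial E},\ \Delta v\in\mathbb P_1(E),\ \int_E(v-\Pi^\nabla_Ev)q=0\ \forall q\in\mathbb P_1(E)\}$, with degrees of freedom the values at the vertices of $E$; $V_h=\{v\in H^1_0(\Omega_h):v_{|E}\in V_E\ \forall E\in\mathcal T_h\}$. **Discrete forms.** $\widetilde\Pi_E:V_E\to\mathcal S_1(E)$ is a linear projection onto a linear subspace $\mathcal S_1(E)\subseteq\mathbb P_1(E)$, computable from the degrees of freedom and continuous in $H^1(E)$ uniformly in $E$ and $h$. With $\mu_E$ the mean of $\mu$ on $E$: $a_E(u,v)=\int_E\mu\,\nabla\Pi^\nabla_Eu\cdot\nabla\Pi^\nabla_Ev+\mu_E\,s_E(u-\widetilde\Pi_Eu,v-\widetilde\Pi_Ev)$, $b_E(u,v)=\frac12\int_E(\mathbf b\cdot\nabla\Pi^\nabla_Eu)\Pi^\nabla_Ev-\frac12\int_E(\mathbf b\cdot\nabla\Pi^\nabla_Ev)\Pi^\nabla_Eu$,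 $c_E(u,v)=\int_E(\sigma-\frac12\nabla\cdot\mathbf b)\Pi^\nabla_Eu\,\Pi^\nabla_Ev$, $\mathcal F_E(v)=\int_Ef\,\Pi^\nabla_Ev$. $a_h=\sum_Ea_E$, $\mathcal B_h=\sum_E(a_E+b_E+c_E)$, $\mathcal F_h=\sum_E\mathcal F_E$ on $V_h$. *)

theory Defs
  imports "HOL-Analysis.Analysis"
begin

type_synonym pt = "real ^ 2"


section \<open>Sobolev spaces on planar sets\<close>

text \<open>Functions are total on the plane; only their values on the set \<open>U\<close> at hand
  (up to null sets) are relevant.\<close>

definition L2_on :: "pt set \<Rightarrow> (pt \<Rightarrow> 'b::euclidean_space) \<Rightarrow> bool" where
  "L2_on U v \<longleftrightarrow> v \<in> borel_measurable (lebesgue_on U) \<and>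
     integrable (lebesgue_on U) (\<lambda>x. (norm (v x))\<^sup>2)"

definition L2_norm :: "pt set \<Rightarrow> (pt \<Rightarrow> 'b::euclidean_space) \<Rightarrow> real" where
  "L2_norm U v = sqrt (LINT x|lebesgue_on U. (norm (v x))\<^sup>2)"

definition Linf_on :: "pt set \<Rightarrow> (pt \<Rightarrow> 'b::euclidean_space) \<Rightarrow> bool" where
  "Linf_on U v \<longleftrightarrow> v \<in> borel_measurable (lebesgue_on U) \<and>
     (\<exists>M. AE x in lebesgue_on U. norm (v x) \<le> M)"

definition loc_integrable_on :: "pt set \<Rightarrow> (pt \<Rightarrow> 'b::euclidean_space) \<Rightarrow> bool" where
  "loc_integrable_on U v \<longleftrightarrow> (\<forall>C. compact C \<and> C \<subseteq> U \<longrightarrow> integrable (lebesgue_on C) v)"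

primrec Ck :: "nat \<Rightarrow> (pt \<Rightarrow> real) \<Rightarrow> bool" where
  "Ck 0 f \<longleftrightarrow> continuous_on UNIV f"
| "Ck (Suc k) f \<longleftrightarrow> (\<forall>x. f differentiable (at x)) \<and>
     (\<forall>e. Ck k (\<lambda>x. frechet_derivative f (at x) e))"

definition smooth :: "(pt \<Rightarrow> real) \<Rightarrow> bool" where
  "smooth f \<longleftrightarrow> (\<forall>k. Ck k f)"

definition test_fun :: "pt set \<Rightarrow> (pt \<Rightarrow> real) \<Rightarrow> bool" where
  "test_fun U \<phi> \<longleftrightarrow> smooth \<phi> \<and> (\<exists>C. compact C \<and> C \<subseteq> U \<and> (\<forall>x. x \<notin> C \<longrightarrow> \<phi> x = 0))"

definition is_weak_grad :: "pt set \<Rightarrow> (pt \<Rightarrow> real) \<Rightarrow> (pt \<Rightarrow> pt) \<Rightarrow> bool" where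
  "is_weak_grad U v g \<longleftrightarrow> loc_integrable_on U v \<and> loc_integrable_on U g \<and>
     (\<forall>\<phi> e. test_fun U \<phi> \<longrightarrow>
        (LINT x|lebesgue_on U. v x * frechet_derivative \<phi> (at x) e) =
        - (LINT x|lebesgue_on U. (g x \<bullet> e) * \<phi> x))"

text \<open>The derivative of \<open>\<phi>\<close> at \<open>x\<close> in direction \<open>b x\<close> is the product of \<open>b x\<close> with the gradient.\<close>

definition is_weak_div :: "pt set \<Rightarrow> (pt \<Rightarrow> pt) \<Rightarrow> (pt \<Rightarrow> real) \<Rightarrow> bool" where
  "is_weak_div U b d \<longleftrightarrow> loc_integrable_on U b \<and> loc_integrable_on U d \<and>
     (\<forall>\<phi>. test_fun U \<phi> \<longrightarrow>
        (LINT x|lebesgue_on U. frechet_derivative \<phi> (at x) (b x)) =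
        - (LINT x|lebesgue_on U. d x * \<phi> x))"

definition grad :: "pt set \<Rightarrow> (pt \<Rightarrow> real) \<Rightarrow> pt \<Rightarrow> pt" where
  "grad U v = (SOME g. is_weak_grad U v g)"

definition H1 :: "pt set \<Rightarrow> (pt \<Rightarrow> real) set" where
  "H1 U = {v. L2_on U v \<and> (\<exists>g. is_weak_grad U v g \<and> L2_on U g)}"

definition H1_semi :: "pt set \<Rightarrow> (pt \<Rightarrow> real) \<Rightarrow> real" where
  "H1_semi U v = L2_norm U (grad U v)"

definition H1_norm :: "pt set \<Rightarrow> (pt \<Rightarrow> real) \<Rightarrow> real" where
  "H1_norm U v = sqrt ((L2_norm U v)\<^sup>2 + (H1_semi U v)\<^sup>2)"

definition H10 :: "pt set \<Rightarrow> (pt \<Rightarrow> real) set" where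
  "H10 U = {v \<in> H1 U. \<exists>\<phi>::nat \<Rightarrow> pt \<Rightarrow> real. (\<forall>n. test_fun U (\<phi> n)) \<and>
     (\<lambda>n. H1_norm U (\<lambda>x. \<phi> n x - v x)) \<longlonglongrightarrow> 0}"

definition W1inf :: "pt set \<Rightarrow> (pt \<Rightarrow> real) set" where
  "W1inf U = {v. Linf_on U v \<and> (\<exists>g. is_weak_grad U v g \<and> Linf_on U g)}"

definition poincare_const :: "pt set \<Rightarrow> real \<Rightarrow> bool" where
  "poincare_const U C \<longleftrightarrow> C > 0 \<and> (\<forall>v\<in>H10 U. L2_norm U v \<le> C * H1_semi U v)"


section \<open>Domains and data\<close>

definition planar_domain :: "pt set \<Rightarrow> bool" where
  "planar_domain U \<longleftrightarrow> U \<noteq> {} \<and> open U \<and> connected U"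

text \<open>Near each boundary point, in suitable orthonormal coordinates, \<open>U\<close> is the strict
  epigraph of a Lipschitz function.\<close>

definition lipschitz_boundary :: "pt set \<Rightarrow> bool" where
  "lipschitz_boundary U \<longleftrightarrow> (\<forall>x\<in>frontier U. \<exists>e1 e2 r d M (\<gamma>::real \<Rightarrow> real).
     norm e1 = 1 \<and> norm e2 = 1 \<and> e1 \<bullet> e2 = 0 \<and> r > 0 \<and> d > 0 \<and> M-lipschitz_on UNIV \<gamma> \<and>
     (\<forall>y. \<bar>(y - x) \<bullet> e1\<bar> < r \<and> \<bar>(y - x) \<bullet> e2\<bar> < d \<longrightarrow>
        (y \<in> U \<longleftrightarrow> (y - x) \<bullet> e2 > \<gamma> ((y - x) \<bullet> e1))))"

text \<open>An arc is a pair of its length \<open>L\<close> and its arclength parametrization on \<open>{0..L}\<close>; the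
  end points may coincide.\<close>

definition C2_arc :: "real \<times> (real \<Rightarrow> pt) \<Rightarrow> bool" where
  "C2_arc a \<longleftrightarrow> (case a of (L, \<gamma>) \<Rightarrow>
     L > 0 \<and> continuous_on {0..L} \<gamma> \<and>
     (\<forall>s\<in>{0..L}. \<forall>t\<in>{0..L}. \<gamma> s = \<gamma> t \<longrightarrow> s = t \<or> {s, t} = {0, L}) \<and>
     (\<exists>\<gamma>' \<gamma>''. (\<forall>t\<in>{0<..<L}. (\<gamma> has_vector_derivative \<gamma>' t) (at t) \<and> norm (\<gamma>' t) = 1 \<and>
                   (\<gamma>' has_vector_derivative \<gamma>'' t) (at t)) \<and>
        continuous_on {0<..<L} \<gamma>'' \<and> bounded (\<gamma>'' ` {0<..<L})))"

definition arc_image :: "real \<times> (real \<Rightarrow> pt) \<Rightarrow> pt set" where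
  "arc_image a = snd a ` {0..fst a}"

definition arc_ends :: "real \<times> (real \<Rightarrow> pt) \<Rightarrow> pt set" where
  "arc_ends a = {snd a 0, snd a (fst a)}"

definition break_points :: "(real \<times> (real \<Rightarrow> pt)) set \<Rightarrow> pt set" where
  "break_points A = (\<Union>a\<in>A. arc_ends a)"

text \<open>\<open>\<theta>\<close> is the interior angle of \<open>U\<close> at \<open>x\<close>: near \<open>x\<close>, up to arbitrarily thin sectors, \<open>U\<close>
  coincides with a sector with vertex \<open>x\<close> and opening \<open>\<theta>\<close>.\<close>

definition interior_angle :: "pt set \<Rightarrow> pt \<Rightarrow> real \<Rightarrow> bool" where
  "interior_angle U x \<theta> \<longleftrightarrow> (\<exists>\<alpha>. \<forall>\<epsilon>>0. \<exists>r>0. \<forall>\<rho> \<phi>. 0 < \<rho> \<and> \<rho> < r \<longrightarrow>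
     (\<alpha> + \<epsilon> < \<phi> \<and> \<phi> < \<alpha> + \<theta> - \<epsilon> \<longrightarrow> x + \<rho> *\<^sub>R vector [cos \<phi>, sin \<phi>] \<in> U) \<and>
     (\<alpha> + \<theta> + \<epsilon> < \<phi> \<and> \<phi> < \<alpha> + 2 * pi - \<epsilon> \<longrightarrow>
        x + \<rho> *\<^sub>R vector [cos \<phi>, sin \<phi>] \<notin> closure U))"

definition piecewise_C2_boundary :: "pt set \<Rightarrow> (real \<times> (real \<Rightarrow> pt)) set \<Rightarrow> bool" where
  "piecewise_C2_boundary U A \<longleftrightarrow> finite A \<and> (\<forall>a\<in>A. C2_arc a) \<and>
     frontier U = (\<Union>a\<in>A. arc_image a) \<and>
     (\<forall>a\<in>A. \<forall>a'\<in>A. a \<noteq> a' \<longrightarrow> arc_image a \<inter> arc_image a' \<subseteq> arc_ends a \<inter> arc_ends a') \<and>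
     (\<forall>x\<in>break_points A. \<exists>\<theta>. 0 < \<theta> \<and> \<theta> < 2 * pi \<and> interior_angle U x \<theta>)"

text \<open>\<open>divb\<close> is the weak divergence of \<open>b\<close>.\<close>

definition admissible_data ::
  "pt set \<Rightarrow> (pt \<Rightarrow> real) \<Rightarrow> (pt \<Rightarrow> pt) \<Rightarrow> (pt \<Rightarrow> real) \<Rightarrow> (pt \<Rightarrow> real) \<Rightarrow> (pt \<Rightarrow> real) \<Rightarrow> real \<Rightarrow> bool"
where
  "admissible_data U \<mu> b divb \<sigma> f \<mu>0 \<longleftrightarrow>
     \<mu> \<in> W1inf U \<and> Linf_on U b \<and> is_weak_div U b divb \<and> Linf_on U divb \<and>
     Linf_on U \<sigma> \<and> L2_on U f \<and>
     \<mu>0 > 0 \<and> (AE x in lebesgue_on U. \<mu> x \<ge> \<mu>0) \<and>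
     (AE x in lebesgue_on U. \<sigma> x - divb x / 2 \<ge> 0)"


section \<open>Meshes\<close>

definition vertices :: "pt set \<Rightarrow> pt set" where
  "vertices K = {x. x extreme_point_of K}"

definition edges :: "pt set \<Rightarrow> pt set set" where
  "edges K = {e. e edge_of K}"

definition background_mesh :: "real \<Rightarrow> real \<Rightarrow> pt set set \<Rightarrow> bool" where
  "background_mesh lam h T \<longleftrightarrow>
     (\<forall>K\<in>T. polytope K \<and> interior K \<noteq> {}) \<and>
     \<Union>T = UNIV \<and>
     (\<forall>K\<in>T. \<forall>K'\<in>T. (K \<inter> K') face_of K \<and> (K \<inter> K') face_of K') \<and>
     (\<forall>K\<in>T. lam * h \<le> diameter K \<and> diameter K \<le> h / lam \<and>
        (\<exists>c r. 2 * r \<ge> lam * diameter K \<and> ball c r \<subseteq> K \<and>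
           (\<forall>y\<in>ball c r. \<forall>x\<in>K. closed_segment y x \<subseteq> K)) \<and>
        (\<forall>e\<in>edges K. diameter e \<ge> lam * diameter K))"

definition active_mesh :: "pt set \<Rightarrow> pt set set \<Rightarrow> pt set set" where
  "active_mesh \<Omega> T = {K \<in> T. vertices K \<inter> \<Omega> \<noteq> {}}"

definition cut_cell :: "pt set \<Rightarrow> pt set \<Rightarrow> pt set" where
  "cut_cell \<Omega> K = convex hull
     ((vertices K \<inter> \<Omega>) \<union> (frontier \<Omega> \<inter> \<Union>{e \<in> edges K. vertices e \<inter> \<Omega> \<noteq> {}}))"

definition trimmed_mesh :: "pt set \<Rightarrow> pt set set \<Rightarrow> pt set set" where
  "trimmed_mesh \<Omega> T = cut_cell \<Omega> ` active_mesh \<Omega> T"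

definition mesh_domain :: "pt set set \<Rightarrow> pt set" where
  "mesh_domain M = interior (\<Union>M)"


section \<open>Traces on the boundary of a convex polygon\<close>

text \<open>Arclength integral over a segment; it does not depend on the chosen order of end points.\<close>

definition edge_integral :: "pt set \<Rightarrow> (pt \<Rightarrow> real) \<Rightarrow> real" where
  "edge_integral e g = (case (SOME (a, b). e = closed_segment a b) of
     (a, b) \<Rightarrow> dist a b * (LINT t|lebesgue_on {0..1}. g (linepath a b t)))"

definition boundary_integral :: "pt set \<Rightarrow> (pt \<Rightarrow> real) \<Rightarrow> real" where
  "boundary_integral E g = (\<Sum>e\<in>edges E. edge_integral e g)"

definition L2_boundary :: "pt set \<Rightarrow> (pt \<Rightarrow> real) \<Rightarrow> bool" where
  "L2_boundary E g \<longleftrightarrow> (\<forall>e\<in>edges E. \<forall>a b. e = closed_segment a b \<longrightarrow>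
     (\<lambda>t. g (linepath a b t)) \<in> borel_measurable (lebesgue_on {0..1}) \<and>
     integrable (lebesgue_on {0..1}) (\<lambda>t. (g (linepath a b t))\<^sup>2))"

text \<open>The trace operator is the continuous extension, from \<open>H1\<close> to \<open>L2\<close> of the boundary, of the
  restriction of smooth functions to the boundary.\<close>

definition is_trace :: "pt set \<Rightarrow> (pt \<Rightarrow> real) \<Rightarrow> (pt \<Rightarrow> real) \<Rightarrow> bool" where
  "is_trace E v g \<longleftrightarrow> v \<in> H1 (interior E) \<and> L2_boundary E g \<and>
     (\<exists>\<phi>::nat \<Rightarrow> pt \<Rightarrow> real. (\<forall>n. smooth (\<phi> n)) \<and>
        (\<lambda>n. H1_norm (interior E) (\<lambda>x. \<phi> n x - v x)) \<longlonglongrightarrow> 0 \<and>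
        (\<lambda>n. boundary_integral E (\<lambda>x. (\<phi> n x - g x)\<^sup>2)) \<longlonglongrightarrow> 0)"

definition trace_on :: "pt set \<Rightarrow> (pt \<Rightarrow> real) \<Rightarrow> pt \<Rightarrow> real" where
  "trace_on E v = (SOME g. is_trace E v g)"


section \<open>Virtual element spaces\<close>

definition P1 :: "(pt \<Rightarrow> real) set" where
  "P1 = {q. \<exists>c d. q = (\<lambda>x. c + d \<bullet> x)}"

definition boundary_space :: "pt set \<Rightarrow> (pt \<Rightarrow> real) set" where
  "boundary_space E = {g. continuous_on (frontier E) g \<and>
     (\<forall>e\<in>edges E. \<exists>q\<in>P1. \<forall>x\<in>e. g x = q x)}"

definition Pi_grad :: "pt set \<Rightarrow> (pt \<Rightarrow> real) \<Rightarrow> pt \<Rightarrow> real" where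
  "Pi_grad E v = (THE p. p \<in> P1 \<and>
     (\<forall>q\<in>P1. (LINT x|lebesgue_on E.
        grad (interior E) (\<lambda>y. v y - p y) x \<bullet> grad (interior E) q x) = 0) \<and>
     boundary_integral E (\<lambda>x. trace_on E v x - p x) = 0)"

definition vem_local :: "pt set \<Rightarrow> (pt \<Rightarrow> real) set" where
  "vem_local E = {v \<in> H1 (interior E).
     (\<exists>g\<in>boundary_space E. is_trace E v g) \<and>
     (\<exists>q\<in>P1. is_weak_div (interior E) (grad (interior E) v) q) \<and>
     (\<forall>q\<in>P1. (LINT x|lebesgue_on E. (v x - Pi_grad E v x) * q x) = 0)}"

definition vem_space :: "pt set set \<Rightarrow> (pt \<Rightarrow> real) set" where
  "vem_space M = {v \<in> H10 (mesh_domain M). \<forall>E\<in>M. v \<in> vem_local E}"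

text \<open>The continuous representative of the trace of a virtual element function; only its values
  on the boundary of \<open>E\<close> are meaningful. At the vertices they are the degrees of freedom.\<close>

definition boundary_values :: "pt set \<Rightarrow> (pt \<Rightarrow> real) \<Rightarrow> pt \<Rightarrow> real" where
  "boundary_values E v = (SOME g. g \<in> boundary_space E \<and> is_trace E v g)"


section \<open>Discrete forms\<close>

text \<open>Linear projection \<open>P\<close> of \<open>vem_local E\<close> onto a linear subspace \<open>S\<close> of \<open>P1\<close>, determined by
  the degrees of freedom, with \<open>H1\<close> continuity constant \<open>C\<close>.\<close>

definition admissible_projection ::
  "pt set \<Rightarrow> (pt \<Rightarrow> real) set \<Rightarrow> ((pt \<Rightarrow> real) \<Rightarrow> pt \<Rightarrow> real) \<Rightarrow> real \<Rightarrow> bool" where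
  "admissible_projection E S P C \<longleftrightarrow>
     S \<subseteq> P1 \<and> (\<lambda>x. 0) \<in> S \<and>
     (\<forall>p\<in>S. \<forall>q\<in>S. \<forall>\<alpha> \<beta>. (\<lambda>x. \<alpha> * p x + \<beta> * q x) \<in> S) \<and>
     (\<forall>v\<in>vem_local E. P v \<in> S) \<and> (\<forall>q\<in>S. P q = q) \<and>
     (\<forall>u\<in>vem_local E. \<forall>v\<in>vem_local E. \<forall>\<alpha> \<beta>.
        P (\<lambda>x. \<alpha> * u x + \<beta> * v x) = (\<lambda>x. \<alpha> * P u x + \<beta> * P v x)) \<and>
     (\<forall>u\<in>vem_local E. \<forall>v\<in>vem_local E.
        (\<forall>x\<in>vertices E. boundary_values E u x = boundary_values E v x) \<longrightarrow> P u = P v) \<and>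
     (\<forall>v\<in>vem_local E. H1_norm (interior E) (P v) \<le> C * H1_norm (interior E) v)"

definition admissible_stabilization ::
  "pt set \<Rightarrow> ((pt \<Rightarrow> real) \<Rightarrow> pt \<Rightarrow> real) \<Rightarrow> ((pt \<Rightarrow> real) \<Rightarrow> (pt \<Rightarrow> real) \<Rightarrow> real) \<Rightarrow>
     real \<Rightarrow> real \<Rightarrow> bool" where
  "admissible_stabilization E P s cs Cs \<longleftrightarrow>
     (\<forall>u\<in>vem_local E. \<forall>v\<in>vem_local E. s u v = s v u) \<and>
     (\<forall>u\<in>vem_local E. \<forall>v\<in>vem_local E. \<forall>w\<in>vem_local E. \<forall>\<alpha> \<beta>.
        s (\<lambda>x. \<alpha> * u x + \<beta> * v x) w = \<alpha> * s u w + \<beta> * s v w) \<and>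
     (\<forall>u\<in>vem_local E. \<forall>u'\<in>vem_local E. \<forall>v\<in>vem_local E. \<forall>v'\<in>vem_local E.
        (\<forall>x\<in>frontier E. boundary_values E u x = boundary_values E u' x) \<longrightarrow>
        (\<forall>x\<in>frontier E. boundary_values E v x = boundary_values E v' x) \<longrightarrow> s u v = s u' v') \<and>
     (\<forall>v\<in>vem_local E. P v = (\<lambda>x. 0) \<longrightarrow>
        cs * (H1_semi (interior E) v)\<^sup>2 \<le> s v v \<and> s v v \<le> Cs * (H1_semi (interior E) v)\<^sup>2)"

definition mean_on :: "pt set \<Rightarrow> (pt \<Rightarrow> real) \<Rightarrow> real" where
  "mean_on E \<mu> = (LINT x|lebesgue_on E. \<mu> x) / measure lebesgue E"

definition a_loc :: "(pt \<Rightarrow> real) \<Rightarrow> ((pt \<Rightarrow> real) \<Rightarrow> pt \<Rightarrow> real) \<Rightarrow>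
    ((pt \<Rightarrow> real) \<Rightarrow> (pt \<Rightarrow> real) \<Rightarrow> real) \<Rightarrow> pt set \<Rightarrow> (pt \<Rightarrow> real) \<Rightarrow> (pt \<Rightarrow> real) \<Rightarrow> real" where
  "a_loc \<mu> P s E u v =
     (LINT x|lebesgue_on E. \<mu> x *
        (grad (interior E) (Pi_grad E u) x \<bullet> grad (interior E) (Pi_grad E v) x)) +
     mean_on E \<mu> * s (\<lambda>x. u x - P u x) (\<lambda>x. v x - P v x)"

definition b_loc :: "(pt \<Rightarrow> pt) \<Rightarrow> pt set \<Rightarrow> (pt \<Rightarrow> real) \<Rightarrow> (pt \<Rightarrow> real) \<Rightarrow> real" where
  "b_loc b E u v =
     (1/2) * (LINT x|lebesgue_on E. (b x \<bullet> grad (interior E) (Pi_grad E u) x) * Pi_grad E v x) -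
     (1/2) * (LINT x|lebesgue_on E. (b x \<bullet> grad (interior E) (Pi_grad E v) x) * Pi_grad E u x)"

definition c_loc :: "(pt \<Rightarrow> real) \<Rightarrow> (pt \<Rightarrow> real) \<Rightarrow> pt set \<Rightarrow> (pt \<Rightarrow> real) \<Rightarrow> (pt \<Rightarrow> real) \<Rightarrow> real"
where
  "c_loc \<sigma> divb E u v =
     (LINT x|lebesgue_on E. (\<sigma> x - divb x / 2) * Pi_grad E u x * Pi_grad E v x)"

definition F_loc :: "(pt \<Rightarrow> real) \<Rightarrow> pt set \<Rightarrow> (pt \<Rightarrow> real) \<Rightarrow> real" where
  "F_loc f E v = (LINT x|lebesgue_on E. f x * Pi_grad E v x)"

text \<open>In the global forms \<open>P E\<close> and \<open>s E\<close> are the projection and the stabilization on \<open>E\<close>.\<close>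

definition a_form where
  "a_form \<mu> P s M u v = (\<Sum>E\<in>M. a_loc \<mu> (P E) (s E) E u v)"

definition B_form where
  "B_form \<mu> b divb \<sigma> P s M u v =
     (\<Sum>E\<in>M. a_loc \<mu> (P E) (s E) E u v + b_loc b E u v + c_loc \<sigma> divb E u v)"

definition F_form where
  "F_form f M v = (\<Sum>E\<in>M. F_loc f E v)"

end

theory Submission
  imports Defs
begin

text \<open>Testing the discrete problem with \<open>uh\<close> itself, the skew-symmetric convection form drops out and
  the reaction form is nonnegative, so \<open>\<mu>star\<close> times the squared seminorm of \<open>uh\<close> is
  at most its load \<open>F_form\<close>. On each cell \<open>Pi_grad\<close> is, by the moment condition in \<open>vem_local\<close>, the
  \<open>L2\<close>-projection onto \<open>P1\<close>, so the load is at most the product of the \<open>L2\<close> norms of \<open>f\<close> and \<open>uh\<close>,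
  and Poincare's inequality bounds the latter. Weak gradients being Hilbert choices, the argument
  rests on their uniqueness almost everywhere; it yields the existence and uniqueness of the
  polynomial in the definition of \<open>Pi_grad\<close>. An infinite mesh needs no argument: all sums over it are 0.\<close>

section \<open>Smooth bump functions\<close>

text \<open>\<open>Pi_grad\<close> is defined through gradients and boundary means, so an L2 bound
  for it is not built in. The moment condition can be tested only with members of \<open>P1\<close>,
  and the one test required is \<open>Pi_grad E v\<close> itself; a \<open>THE\<close> description
  yields this membership only after existence and uniqueness are known. Hence the long analytic
  preparation: uniqueness of weak gradients rests on the fundamental lemma of the calculus of
  variations, which requires test functions smooth in the sense of \<open>Ck\<close>, and these are
  built from exp (-1/t). Two mismatches shape the rest. The forms integrate over closed cells, while
  weak gradients and norms live on their interiors; convexity makes the difference a null set. The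
  Poincare constant belongs to \<open>\<Omega>t\<close>, while the seminorm is taken on the mesh
  domain; \<open>h0 \<le> lam * \<delta>0\<close> places every cell inside \<open>\<Omega>t\<close>,
  and the definition of \<open>H10\<close> by approximation replaces an extension operator.\<close>

definition exp_inv :: "nat \<Rightarrow> real \<Rightarrow> real" where
  "exp_inv k t = (if t > 0 then exp (- 1 / t) / t ^ k else 0)"

lemma exp_inv_nonneg: "0 \<le> exp_inv k t"
  by (simp add: exp_inv_def)

lemma exp_inv_0_le_1: "exp_inv 0 t \<le> 1"
  by (simp add: exp_inv_def)

lemma exp_inv_tendsto_0: "((\<lambda>t. exp_inv k t) \<longlongrightarrow> 0) (at 0)"
proof -
  have "((\<lambda>t::real. (inverse t) ^ k / exp (inverse t)) \<longlongrightarrow> 0) (at_right 0)"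
    by (rule filterlim_compose[OF tendsto_power_div_exp_0 filterlim_inverse_at_top_right])
  then have "((\<lambda>t. exp_inv k t) \<longlongrightarrow> 0) (at_right 0)"
    by (rule Lim_transform_eventually)
      (auto simp: eventually_at_filter exp_inv_def field_simps exp_minus power_inverse)
  moreover have "((\<lambda>t. exp_inv k t) \<longlongrightarrow> 0) (at_left 0)"
    by (rule tendsto_eventually) (auto simp: eventually_at_filter exp_inv_def)
  ultimately show ?thesis
    by (simp add: filterlim_split_at)
qed

text \<open>The power in the denominator is carried along for this formula: it closes the family
  under differentiation, up to linear combinations, so that one induction covers all orders.\<close>

lemma exp_inv_has_derivative:
  "(exp_inv k has_real_derivative exp_inv (k + 2) t - real k * exp_inv (k + 1) t) (at t)"
proof -
  consider "t > 0" | "t = 0" | "t < 0" by linarith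
  then show ?thesis
  proof cases
    case 1
    have *: "((\<lambda>t. exp (- 1 / t) / t ^ k) has_real_derivative
        exp (- 1 / t) / t ^ (k + 2) - real k * (exp (- 1 / t) / t ^ (k + 1))) (at t)"
    proof (cases k)
      case 0
      with 1 show ?thesis
        by (auto intro!: derivative_eq_intros simp: power2_eq_square)
    next
      case (Suc m)
      have "m - Suc 0 = 0 \<or> t * t ^ (m - Suc 0 - Suc 0) = t ^ (m - Suc 0)"
        by (cases "m - Suc 0") auto
      with Suc 1 show ?thesis
        by (cases m) (auto intro!: derivative_eq_intros simp: field_simps power2_eq_square)
    qed
    show ?thesis
      by (rule has_field_derivative_transform_within_open[where S="{0<..}"])
        (use 1 * in \<open>auto simp: exp_inv_def\<close>)
  next
    case 2
    \<comment> \<open>Since \<open>exp_inv k 0\<close> is 0, the difference quotient of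
      \<open>exp_inv k\<close> at 0 is exactly \<open>exp_inv (k + 1)\<close>.\<close>
    have "((\<lambda>y. exp_inv (k + 1) y) \<longlongrightarrow> 0) (at 0)"
      by (rule exp_inv_tendsto_0)
    then have "((\<lambda>y. (exp_inv k y - exp_inv k 0) / (y - 0)) \<longlongrightarrow> 0) (at 0)"
      by (rule Lim_transform_eventually) (auto simp: eventually_at_filter exp_inv_def field_simps)
    then show ?thesis
      using 2 by (simp add: has_field_derivative_iff exp_inv_def)
  next
    case 3
    show ?thesis
      by (rule has_field_derivative_transform_within_open[where S="{..<0}" and f="\<lambda>_. 0"])
        (use 3 in \<open>auto simp: exp_inv_def\<close>)
  qed
qed

text \<open>This class is closed under directional derivatives, which makes its members smooth.\<close>

inductive bump_class :: "(pt \<Rightarrow> real) \<Rightarrow> bool" where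
  const: "bump_class (\<lambda>x. c)"
| linear: "bump_class (\<lambda>x. a \<bullet> x)"
| exp_inv: "bump_class (\<lambda>x. exp_inv k (a \<bullet> x + c))"
| add: "bump_class f \<Longrightarrow> bump_class g \<Longrightarrow> bump_class (\<lambda>x. f x + g x)"
| mult: "bump_class f \<Longrightarrow> bump_class g \<Longrightarrow> bump_class (\<lambda>x. f x * g x)"

lemma bump_class_derivative:
  "bump_class f \<Longrightarrow> \<exists>D. (\<forall>x. (f has_derivative D x) (at x)) \<and> (\<forall>e. bump_class (\<lambda>x. D x e))"
proof (induction rule: bump_class.induct)
  case (const c)
  show ?case
    by (rule exI[of _ "\<lambda>x e. 0"]) (auto intro: bump_class.intros)
next
  case (linear a)
  show ?case
    by (rule exI[of _ "\<lambda>x e. a \<bullet> e"])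
      (auto intro: bump_class.intros bounded_linear_imp_has_derivative bounded_linear_inner_right)
next
  case (exp_inv k a c)
  let ?d = "\<lambda>x. exp_inv (k + 2) (a \<bullet> x + c) + (- real k) * exp_inv (k + 1) (a \<bullet> x + c)"
  have "((\<lambda>x. exp_inv k (a \<bullet> x + c)) has_derivative (\<lambda>e. ?d x * (a \<bullet> e))) (at x)" for x
  proof -
    have "((\<lambda>x. a \<bullet> x + c) has_derivative (\<lambda>e. a \<bullet> e)) (at x)"
      by (auto intro!: derivative_eq_intros)
    then show ?thesis
      using has_derivative_compose[where f="\<lambda>x. a \<bullet> x + c" and g="exp_inv k",
          OF _ exp_inv_has_derivative[of k "a \<bullet> x + c", unfolded has_field_derivative_def]]
      by simp
  qed
  moreover have "bump_class (\<lambda>x. ?d x * (a \<bullet> e))" for e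
    by (intro bump_class.intros)
  ultimately show ?case
    by (intro exI[of _ "\<lambda>x e. ?d x * (a \<bullet> e)"]) blast
next
  case (add f g)
  then obtain F G where "\<forall>x. (f has_derivative F x) (at x)" "\<forall>e. bump_class (\<lambda>x. F x e)"
    "\<forall>x. (g has_derivative G x) (at x)" "\<forall>e. bump_class (\<lambda>x. G x e)" by blast
  then show ?case
    by (intro exI[of _ "\<lambda>x e. F x e + G x e"])
      (auto intro: bump_class.intros has_derivative_add)
next
  case (mult f g)
  then obtain F G where "\<forall>x. (f has_derivative F x) (at x)" "\<forall>e. bump_class (\<lambda>x. F x e)"
    "\<forall>x. (g has_derivative G x) (at x)" "\<forall>e. bump_class (\<lambda>x. G x e)" by blast
  moreover from this mult.hyps have "bump_class (\<lambda>x. f x * G x e + F x e * g x)" for e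
    by (intro bump_class.add bump_class.mult) auto
  ultimately show ?case
    by (intro exI[of _ "\<lambda>x e. f x * G x e + F x e * g x"])
      (auto intro: has_derivative_mult)
qed

lemma bump_class_imp_smooth:
  assumes "bump_class f"
  shows "smooth f"
proof -
  have "Ck k f" if "bump_class f" for k f
    using that
  proof (induction k arbitrary: f)
    case 0
    with bump_class_derivative obtain D where "\<forall>x. (f has_derivative D x) (at x)" by blast
    then show ?case
      using has_derivative_continuous continuous_at_imp_continuous_on by simp blast
  next
    case (Suc k)
    with bump_class_derivative obtain D
      where D: "\<forall>x. (f has_derivative D x) (at x)" "\<forall>e. bump_class (\<lambda>x. D x e)" by blast
    then have "frechet_derivative f (at x) = D x" for x
      by (metis frechet_derivative_at)
    with D Suc show ?case
      by (auto simp: differentiable_def)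
  qed
  with assms show ?thesis
    by (simp add: smooth_def)
qed

lemma smooth_continuous: "smooth f \<Longrightarrow> continuous_on UNIV f"
  unfolding smooth_def using Ck.simps(1) by blast

lemma smooth_has_derivative:
  "smooth f \<Longrightarrow> (f has_derivative frechet_derivative f (at x)) (at x)"
  unfolding smooth_def using Ck.simps(2)[of 0 f] frechet_derivative_works by blast

lemma smooth_frechet_derivative:
  "smooth f \<Longrightarrow> smooth (\<lambda>x. frechet_derivative f (at x) e)"
  unfolding smooth_def using Ck.simps(2) by blast

lemma smooth_affine: "smooth (\<lambda>x. c + d \<bullet> x)"
  by (intro bump_class_imp_smooth bump_class.intros)

lemma frechet_derivative_affine: "frechet_derivative (\<lambda>x. c + d \<bullet> x) (at x) = (\<lambda>e. d \<bullet> e)"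
  by (rule frechet_derivative_at[symmetric]) (auto intro!: derivative_eq_intros)

text \<open>A smooth approximation, from below, of the indicator of \<open>box a b\<close>: inside
  the box each factor is exp (-1/(n t)) with t the distance to the line carrying a side, so it tends
  to 1, and one factor vanishes as soon as a coordinate leaves the box.\<close>

definition box_bump :: "pt \<Rightarrow> pt \<Rightarrow> nat \<Rightarrow> pt \<Rightarrow> real" where
  "box_bump a b n x = (\<Prod>i\<in>UNIV. exp_inv 0 (real n * (x $ i - a $ i)) * exp_inv 0 (real n * (b $ i - x $ i)))"

lemma exp_inv_0_scaled_tendsto: "(\<lambda>n. exp_inv 0 (real n * t)) \<longlonglongrightarrow> (if t > 0 then 1 else 0)"
proof (cases "t > 0")
  case True
  have "(\<lambda>n. exp (- (1 / t) * (1 / real n))) \<longlonglongrightarrow> exp (- (1 / t) * 0)"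
    by (intro tendsto_intros lim_1_over_n)
  then have "(\<lambda>n. exp (- (1 / t) * (1 / real n))) \<longlonglongrightarrow> 1" by simp
  then have "(\<lambda>n. exp_inv 0 (real n * t)) \<longlonglongrightarrow> 1"
    by (rule Lim_transform_eventually)
      (use True in \<open>auto simp: eventually_sequentially exp_inv_def field_simps intro!: exI[of _ 1]\<close>)
  with True show ?thesis by simp
next
  case False
  then have "exp_inv 0 (real n * t) = 0" for n
    by (simp add: exp_inv_def zero_less_mult_iff)
  with False show ?thesis by simp
qed

lemma box_bump_tendsto: "(\<lambda>n. box_bump a b n x) \<longlonglongrightarrow> indicator (box a b) x"
proof -
  have "(\<lambda>n. box_bump a b n x) \<longlonglongrightarrow>
      (\<Prod>i\<in>UNIV. (if x $ i - a $ i > 0 then 1 else 0) * (if b $ i - x $ i > 0 then 1 else (0::real)))"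
    unfolding box_bump_def by (intro tendsto_intros exp_inv_0_scaled_tendsto)
  moreover have "(\<Prod>i\<in>UNIV. (if x $ i - a $ i > 0 then 1 else 0) * (if b $ i - x $ i > 0 then 1 else 0))
      = (indicator (box a b) x :: real)"
    by (auto simp: mem_box_cart indicator_def UNIV_2 forall_2)
  ultimately show ?thesis by simp
qed

lemma box_bump_nonneg: "0 \<le> box_bump a b n x"
  unfolding box_bump_def by (intro prod_nonneg mult_nonneg_nonneg) (auto simp: exp_inv_nonneg)

lemma box_bump_le_1: "box_bump a b n x \<le> 1"
  unfolding box_bump_def
  by (intro prod_le_1 conjI mult_nonneg_nonneg mult_le_one) (auto simp: exp_inv_nonneg exp_inv_0_le_1)

lemma test_fun_box_bump:
  assumes "cbox a b \<subseteq> U"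
  shows "test_fun U (box_bump a b n)"
proof -
  have "bump_class (\<lambda>x. exp_inv 0 (real n * (x $ i - a $ i)))" for i
    using bump_class.exp_inv[of 0 "axis i (real n)" "- real n * a $ i"]
    by (simp add: inner_axis' algebra_simps)
  moreover have "bump_class (\<lambda>x. exp_inv 0 (real n * (b $ i - x $ i)))" for i
    using bump_class.exp_inv[of 0 "axis i (- real n)" "real n * b $ i"]
    by (simp add: inner_axis' algebra_simps)
  ultimately have "bump_class (box_bump a b n)"
    unfolding box_bump_def UNIV_2 by (simp add: bump_class.mult)
  then have "smooth (box_bump a b n)"
    by (rule bump_class_imp_smooth)
  moreover have "box_bump a b n x = 0" if "x \<notin> cbox a b" for x
  proof -
    obtain i where "x $ i < a $ i \<or> b $ i < x $ i"
      using \<open>x \<notin> cbox a b\<close> by (auto simp: mem_box_cart not_le)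
    then have "exp_inv 0 (real n * (x $ i - a $ i)) * exp_inv 0 (real n * (b $ i - x $ i)) = 0"
      by (auto simp: exp_inv_def zero_less_mult_iff)
    then show ?thesis
      unfolding box_bump_def by (intro prod_zero) auto
  qed
  ultimately show ?thesis
    unfolding test_fun_def using assms compact_cbox by blast
qed


section \<open>Integration by parts\<close>

lemma integrable_lebesgue_on_compact:
  fixes f :: "'a::euclidean_space \<Rightarrow> 'b::euclidean_space"
  assumes "compact C" "continuous_on C f"
  shows "integrable (lebesgue_on C) f"
proof -
  have [simp]: "C \<in> sets borel"
    using assms(1) by (simp add: borel_compact)
  have "integrable lebesgue (\<lambda>x. indicator C x *\<^sub>R f x)"
    using borel_integrable_compact[OF assms]
    by (subst integrable_completion) (simp_all add: borel_measurable_continuous_on_indicator assms(2))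
  then show ?thesis
    by (simp add: integrable_restrict_space)
qed

lemma integrable_lborel_compact_support:
  fixes f :: "'a::euclidean_space \<Rightarrow> 'b::euclidean_space"
  assumes "compact C" "continuous_on UNIV f" "\<And>x. x \<notin> C \<Longrightarrow> f x = 0"
  shows "integrable lborel f"
proof -
  have "(\<lambda>x. indicator C x *\<^sub>R f x) = f"
    using assms(3) by (auto simp: indicator_def)
  then show ?thesis
    using borel_integrable_compact[OF assms(1) continuous_on_subset[OF assms(2)]] by simp
qed

lemma compact_support_bounded:
  fixes f :: "'a::euclidean_space \<Rightarrow> 'b::euclidean_space"
  assumes "compact C" "continuous_on UNIV f" "\<And>x. x \<notin> C \<Longrightarrow> f x = 0"
  obtains M where "M > 0" "\<And>x. norm (f x) \<le> M"
proof -
  have "bounded (f ` C)"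
    by (intro compact_imp_bounded compact_continuous_image continuous_on_subset[OF assms(2)] assms) auto
  then obtain M where M: "M > 0" "\<And>x. x \<in> C \<Longrightarrow> norm (f x) \<le> M"
    unfolding bounded_pos by blast
  with that[of M] assms(3) show ?thesis
    by (metis less_eq_real_def norm_zero)
qed

lemma has_derivative_zero_outside:
  fixes f :: "'a::euclidean_space \<Rightarrow> 'b::real_normed_vector"
  assumes "(f has_derivative D) (at x)" "compact C" "\<And>x. x \<notin> C \<Longrightarrow> f x = 0" "x \<notin> C"
  shows "D = (\<lambda>e. 0)"
proof -
  have "(f has_derivative (\<lambda>e. 0)) (at x)"
    by (rule has_derivative_transform_within_open[where f="\<lambda>_. 0" and s="- C"])
      (use assms in \<open>auto simp: compact_imp_closed open_Compl\<close>)
  with assms(1) show ?thesis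
    by (rule has_derivative_unique)
qed

lemma integral_lborel_translate:
  fixes f :: "'a::euclidean_space \<Rightarrow> real"
  assumes "continuous_on UNIV f"
  shows "(LINT x|lborel. f (x + c)) = (LINT x|lborel. f x)"
proof -
  have "(LINT x|lborel. f x) = (LINT x|distr lborel borel ((+) c). f x)"
    by (simp add: lborel_distr_plus)
  also have "\<dots> = (LINT x|lborel. f (c + x))"
    by (intro integral_distr) (use assms in \<open>auto intro!: borel_measurable_continuous_onI\<close>)
  finally show ?thesis
    by (simp add: add.commute)
qed

text \<open>The integral of the derivative is the limit of the integrals of the difference quotients,
  which vanish by translation invariance.\<close>

lemma integral_directional_derivative_zero:
  fixes \<psi> :: "'a::euclidean_space \<Rightarrow> real"
  assumes D: "\<And>x. (\<psi> has_derivative D x) (at x)"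
    and cont: "continuous_on UNIV (\<lambda>x. D x e)"
    and C: "compact C" "\<And>x. x \<notin> C \<Longrightarrow> \<psi> x = 0"
  shows "(LINT x|lebesgue. D x e) = 0"
proof -
  have c\<psi>: "continuous_on UNIV \<psi>"
    using D has_derivative_continuous continuous_at_imp_continuous_on by blast
  have D0: "D x e = 0" if "x \<notin> C" for x
    using has_derivative_zero_outside[OF D C that] by simp
  obtain M where M: "M > 0" "\<And>x. norm (D x e) \<le> M"
    using compact_support_bounded[OF C(1) cont D0] by blast
  obtain r where r: "C \<subseteq> cball 0 r"
    using compact_imp_bounded[OF C(1)] unfolding bounded_iff by (auto simp: subset_iff)
  \<comment> \<open>The shifts in the difference quotients \<open>q n\<close> are at most
    \<open>norm e\<close> long, so all quotients vanish outside this one ball.\<close>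
  define B where "B = cball (0::'a) (r + norm e)"
  define q where "q = (\<lambda>n x. (\<psi> (x + (1 / real (Suc n)) *\<^sub>R e) - \<psi> x) * real (Suc n))"
  have int\<psi>: "integrable lborel \<psi>"
    by (rule integrable_lborel_compact_support[OF C(1) c\<psi> C(2)])
  have ct: "continuous_on UNIV (\<lambda>x. \<psi> (x + c))" for c
    by (rule continuous_on_compose2[OF c\<psi>]) (auto intro!: continuous_intros)
  have line: "((\<lambda>t. \<psi> (x + t *\<^sub>R e)) has_real_derivative D (x + t *\<^sub>R e) e) (at t)" for x t
  proof -
    have "((\<lambda>t. x + t *\<^sub>R e) has_derivative (\<lambda>s. s *\<^sub>R e)) (at t)"
      by (auto intro!: derivative_eq_intros)
    from has_derivative_compose[OF this D]
    have "((\<lambda>t. \<psi> (x + t *\<^sub>R e)) has_derivative (\<lambda>s. D (x + t *\<^sub>R e) (s *\<^sub>R e))) (at t)" .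
    moreover have "(\<lambda>s. D (x + t *\<^sub>R e) (s *\<^sub>R e)) = (\<lambda>s. D (x + t *\<^sub>R e) e * s)"
      using has_derivative_linear[OF D] by (auto simp: linear_cmul)
    ultimately show ?thesis
      by (simp add: has_field_derivative_def)
  qed
  have "(\<lambda>n. LINT x|lborel. q n x) \<longlonglongrightarrow> (LINT x|lborel. D x e)"
  proof (rule integral_dominated_convergence[where w="\<lambda>x. M * indicator B x"])
    show "(\<lambda>x. D x e) \<in> borel_measurable lborel"
      using cont by (simp add: borel_measurable_continuous_onI)
    show "q n \<in> borel_measurable lborel" for n
      unfolding q_def using ct c\<psi>
      by (auto intro!: borel_measurable_continuous_onI continuous_intros)
    have "emeasure lborel B < \<infinity>"
      unfolding B_def by (intro emeasure_bounded_finite) auto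
    then show "integrable lborel (\<lambda>x. M * indicator B x)"
      unfolding B_def by (intro integrable_mult_right integrable_real_indicator) auto
    show "AE x in lborel. (\<lambda>n. q n x) \<longlonglongrightarrow> D x e"
    proof (rule AE_I2)
      fix x
      have "((\<lambda>t. (\<psi> (x + t *\<^sub>R e) - \<psi> x) / t) \<longlongrightarrow> D x e) (at 0)"
        using line[of x 0] by (simp add: has_field_derivative_iff)
      moreover have "filterlim (\<lambda>n. 1 / real (Suc n)) (at 0) sequentially"
        unfolding filterlim_at
        using LIMSEQ_inverse_real_of_nat by (auto simp: inverse_eq_divide)
      ultimately have "(\<lambda>n. (\<psi> (x + (1 / real (Suc n)) *\<^sub>R e) - \<psi> x) / (1 / real (Suc n))) \<longlonglongrightarrow> D x e"
        by (rule filterlim_compose)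
      then show "(\<lambda>n. q n x) \<longlonglongrightarrow> D x e"
        by (simp add: q_def)
    qed
    show "AE x in lborel. norm (q n x) \<le> M * indicator B x" for n
    proof (rule AE_I2)
      fix x
      let ?t = "1 / real (Suc n)"
      have t: "0 < ?t" "?t \<le> 1" by auto
      show "norm (q n x) \<le> M * indicator B x"
      proof (cases "x \<in> B")
        \<comment> \<open>The mean value theorem along the line through \<open>x\<close> in
          direction \<open>e\<close> bounds the quotient by the bound \<open>M\<close> of the
          derivative, uniformly in \<open>n\<close>.\<close>
        case True
        obtain z where "\<psi> (x + ?t *\<^sub>R e) - \<psi> (x + 0 *\<^sub>R e) = (?t - 0) * D (x + z *\<^sub>R e) e"
          using MVT2[OF t(1), of "\<lambda>t. \<psi> (x + t *\<^sub>R e)" "\<lambda>t. D (x + t *\<^sub>R e) e"] line by blast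
        then have "q n x = D (x + z *\<^sub>R e) e"
          by (simp add: q_def)
        with M True show ?thesis by simp
      next
        case False
        have "norm (?t *\<^sub>R e) \<le> norm e"
          unfolding norm_scaleR by (rule mult_left_le_one_le) auto
        moreover have "norm x \<le> norm (x + ?t *\<^sub>R e) + norm (?t *\<^sub>R e)"
          by (metis add_diff_cancel norm_triangle_ineq4)
        moreover have "r + norm e < norm x"
          using False by (simp add: B_def)
        ultimately have "x + ?t *\<^sub>R e \<notin> cball 0 r" "x \<notin> cball 0 r"
          using norm_ge_zero[of e] unfolding mem_cball dist_0_norm by linarith+
        with r C(2) have "\<psi> (x + ?t *\<^sub>R e) = 0" "\<psi> x = 0"
          by blast+
        then show ?thesis
          using M False by (simp add: q_def)
      qed
    qed
  qed
  moreover have "(LINT x|lborel. q n x) = 0" for n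
  proof -
    let ?c = "(1 / real (Suc n)) *\<^sub>R e"
    have "integrable lborel (\<lambda>x. \<psi> (x + ?c))"
    proof (rule integrable_lborel_compact_support[OF _ ct])
      show "compact ((\<lambda>x. x - ?c) ` C)"
        by (intro compact_continuous_image continuous_intros C(1))
      show "\<psi> (x + ?c) = 0" if "x \<notin> (\<lambda>x. x - ?c) ` C" for x
      proof (rule C(2))
        show "x + ?c \<notin> C"
          using that imageI[of "x + ?c" C "\<lambda>x. x - ?c"] by auto
      qed
    qed
    then show ?thesis
      unfolding q_def using int\<psi> integral_lborel_translate[OF c\<psi>, of ?c]
      by simp
  qed
  ultimately have "(LINT x|lborel. D x e) = 0"
    by (simp add: LIMSEQ_const_iff)
  then show ?thesis
    by (subst integral_completion) (use cont in \<open>auto intro: borel_measurable_continuous_onI\<close>)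
qed

lemma integral_lebesgue_on_support:
  fixes f :: "'a::euclidean_space \<Rightarrow> 'b::euclidean_space"
  assumes "C \<subseteq> U" "\<And>x. x \<notin> C \<Longrightarrow> f x = 0" "U \<in> sets lebesgue" "C \<in> sets lebesgue"
  shows "integral\<^sup>L (lebesgue_on U) f = integral\<^sup>L (lebesgue_on C) f"
    and "integrable (lebesgue_on U) f \<longleftrightarrow> integrable (lebesgue_on C) f"
proof -
  have "(\<lambda>x. indicator U x *\<^sub>R f x) = (\<lambda>x. indicator C x *\<^sub>R f x)"
    using assms(1,2) by (fastforce simp: indicator_def)
  then show "integral\<^sup>L (lebesgue_on U) f = integral\<^sup>L (lebesgue_on C) f"
    "integrable (lebesgue_on U) f \<longleftrightarrow> integrable (lebesgue_on C) f"
    using assms(3,4) by (simp_all add: integral_restrict_space integrable_restrict_space)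
qed

lemma test_fun_support:
  assumes "test_fun U \<phi>"
  obtains C where "compact C" "C \<subseteq> U" "C \<in> sets lebesgue" "\<And>x. x \<notin> C \<Longrightarrow> \<phi> x = 0"
    "\<And>x e. x \<notin> C \<Longrightarrow> frechet_derivative \<phi> (at x) e = 0"
proof -
  obtain C where C: "compact C" "C \<subseteq> U" "\<And>x. x \<notin> C \<Longrightarrow> \<phi> x = 0" and "smooth \<phi>"
    using assms unfolding test_fun_def by blast
  then have "frechet_derivative \<phi> (at x) e = 0" if "x \<notin> C" for x e
    using has_derivative_zero_outside[OF smooth_has_derivative C(1,3) that] by simp
  with that C show ?thesis
    by (metis borel_compact sets_completionI_sets sets_lborel)
qed

text \<open>The product of \<open>f\<close> and \<open>\<phi>\<close> has compact support, so its
  directional derivative has integral 0; the product rule splits this integral into the two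
  sides.\<close>

lemma smooth_integration_by_parts:
  assumes f: "smooth f" and \<phi>: "test_fun U \<phi>" and U: "open U"
  shows "(LINT x|lebesgue_on U. f x * frechet_derivative \<phi> (at x) e) =
    - (LINT x|lebesgue_on U. frechet_derivative f (at x) e * \<phi> x)"
proof -
  obtain C where C: "compact C" "C \<subseteq> U" "C \<in> sets lebesgue" "\<And>x. x \<notin> C \<Longrightarrow> \<phi> x = 0"
    "\<And>x e. x \<notin> C \<Longrightarrow> frechet_derivative \<phi> (at x) e = 0"
    using test_fun_support[OF \<phi>] by metis
  have s\<phi>: "smooth \<phi>"
    using \<phi> by (simp add: test_fun_def)
  let ?g1 = "\<lambda>x. f x * frechet_derivative \<phi> (at x) e"
  let ?g2 = "\<lambda>x. frechet_derivative f (at x) e * \<phi> x"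
  have cont: "continuous_on UNIV ?g1" "continuous_on UNIV ?g2"
    using f s\<phi> by (auto intro!: continuous_intros intro: smooth_continuous smooth_frechet_derivative)
  have int: "integrable (lebesgue_on C) ?g1" "integrable (lebesgue_on C) ?g2"
    using C(1) continuous_on_subset[OF cont(1)] continuous_on_subset[OF cont(2)]
    by (auto intro!: integrable_lebesgue_on_compact)
  have U': "U \<in> sets lebesgue" using U by auto
  have "(LINT x|lebesgue. ?g1 x + ?g2 x) = 0"
    by (rule integral_directional_derivative_zero[OF _ _ C(1), of "\<lambda>x. f x * \<phi> x"
          "\<lambda>x e. f x * frechet_derivative \<phi> (at x) e + frechet_derivative f (at x) e * \<phi> x"])
      (use C(4) f s\<phi> cont in \<open>auto intro!: has_derivative_mult smooth_has_derivative continuous_on_add\<close>)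
  then have "(LINT x|lebesgue_on C. ?g1 x + ?g2 x) = 0"
    using integral_lebesgue_on_support(1)[of C UNIV "\<lambda>x. ?g1 x + ?g2 x"] C by (simp add: lebesgue_on_UNIV_eq)
  then have "(LINT x|lebesgue_on C. ?g1 x) + (LINT x|lebesgue_on C. ?g2 x) = 0"
    using int by simp
  then show ?thesis
    using integral_lebesgue_on_support(1)[of C U ?g1] integral_lebesgue_on_support(1)[of C U ?g2] C U'
    by simp
qed

text \<open>The classical gradient. It turns the Frechet derivatives of \<open>Ck\<close> into the
  vector field that \<open>is_weak_grad\<close> expects.\<close>

definition smooth_grad :: "(pt \<Rightarrow> real) \<Rightarrow> pt \<Rightarrow> pt" where
  "smooth_grad f x = (\<Sum>b\<in>Basis. frechet_derivative f (at x) b *\<^sub>R b)"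

lemma inner_smooth_grad:
  assumes "smooth f"
  shows "smooth_grad f x \<bullet> e = frechet_derivative f (at x) e"
proof -
  have lin: "linear (frechet_derivative f (at x))"
    using smooth_has_derivative[OF assms] by (rule has_derivative_linear)
  have "frechet_derivative f (at x) e = frechet_derivative f (at x) (\<Sum>b\<in>Basis. (e \<bullet> b) *\<^sub>R b)"
    by (simp add: euclidean_representation)
  also have "\<dots> = smooth_grad f x \<bullet> e"
    unfolding smooth_grad_def linear_sum[OF lin]
    by (simp add: linear_cmul[OF lin] inner_sum_left inner_commute[of e] mult.commute)
  finally show ?thesis by simp
qed

lemma continuous_smooth_grad: "smooth f \<Longrightarrow> continuous_on UNIV (smooth_grad f)"
  unfolding smooth_grad_def[abs_def]
  by (intro continuous_intros smooth_continuous smooth_frechet_derivative)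

lemma is_weak_grad_smooth:
  assumes "open U" "smooth f"
  shows "is_weak_grad U f (smooth_grad f)"
proof -
  have "loc_integrable_on U f" "loc_integrable_on U (smooth_grad f)"
    unfolding loc_integrable_on_def
    using integrable_lebesgue_on_compact continuous_on_subset[OF smooth_continuous[OF assms(2)]]
      continuous_on_subset[OF continuous_smooth_grad[OF assms(2)]] by blast+
  then show ?thesis
    unfolding is_weak_grad_def
    using assms smooth_integration_by_parts by (simp add: inner_smooth_grad)
qed

lemma loc_integrable_mult_compact_support:
  fixes v :: "pt \<Rightarrow> 'b::euclidean_space" and \<psi> :: "pt \<Rightarrow> real"
  assumes "open U" "loc_integrable_on U v" "continuous_on UNIV \<psi>" "compact C" "C \<subseteq> U"
    "\<And>x. x \<notin> C \<Longrightarrow> \<psi> x = 0"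
  shows "integrable (lebesgue_on U) (\<lambda>x. \<psi> x *\<^sub>R v x)"
proof -
  have sets: "U \<in> sets lebesgue" "C \<in> sets lebesgue"
    using assms by (auto simp: borel_compact)
  have v: "integrable (lebesgue_on C) v"
    using assms by (auto simp: loc_integrable_on_def)
  obtain M where M: "M > 0" "\<And>x. norm (\<psi> x) \<le> M"
    using compact_support_bounded[OF assms(4,3,6)] by blast
  have "integrable (lebesgue_on C) (\<lambda>x. \<psi> x *\<^sub>R v x)"
  proof (rule Bochner_Integration.integrable_bound)
    show "integrable (lebesgue_on C) (\<lambda>x. M *\<^sub>R v x)"
      using v by simp
    have "\<psi> \<in> borel_measurable (lebesgue_on C)"
      using continuous_imp_measurable_on_sets_lebesgue[OF continuous_on_subset[OF assms(3)] sets(2)]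
      by simp
    with v show "(\<lambda>x. \<psi> x *\<^sub>R v x) \<in> borel_measurable (lebesgue_on C)"
      by measurable
    show "AE x in lebesgue_on C. norm (\<psi> x *\<^sub>R v x) \<le> norm (M *\<^sub>R v x)"
      using M by (auto intro!: AE_I2 mult_right_mono)
  qed
  then show ?thesis
    using integral_lebesgue_on_support(2)[of C U "\<lambda>x. \<psi> x *\<^sub>R v x"] assms sets by simp
qed


section \<open>Uniqueness of weak gradients\<close>

text \<open>Testing with the functions \<open>box_bump\<close> shows that the integrals of \<open>w\<close> over small boxes vanish;
  Lebesgue's differentiation theorem then yields \<open>w = 0\<close> almost everywhere.\<close>

lemma integral_cbox_zero_if_test_zero:
  assumes "open U" and w: "loc_integrable_on U w"
    and zero: "\<And>\<phi>. test_fun U \<phi> \<Longrightarrow> (LINT x|lebesgue_on U. w x * \<phi> x) = 0"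
    and ab: "cbox a b \<subseteq> U"
  shows "integral (cbox a b) w = (0::real)"
proof -
  let ?C = "cbox a b"
  have intw: "integrable (lebesgue_on ?C) w"
    using w ab by (auto simp: loc_integrable_on_def)
  have bb0: "box_bump a b n x = 0" if "x \<notin> ?C" for n x
  proof -
    have "test_fun ?C (box_bump a b n)"
      by (rule test_fun_box_bump) simp
    then show ?thesis
      using that unfolding test_fun_def by blast
  qed
  have meas: "box_bump a b n \<in> borel_measurable (lebesgue_on ?C)" for n
    using test_fun_box_bump[OF ab, of n]
    by (intro continuous_imp_measurable_on_sets_lebesgue continuous_on_subset[OF smooth_continuous])
      (auto simp: test_fun_def)
  have "(\<lambda>n. LINT x|lebesgue_on ?C. w x * box_bump a b n x) \<longlonglongrightarrow> (LINT x|lebesgue_on ?C. w x)"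
  proof (rule integral_dominated_convergence[where w="\<lambda>x. norm (w x)"])
    show "w \<in> borel_measurable (lebesgue_on ?C)" "integrable (lebesgue_on ?C) (\<lambda>x. norm (w x))"
      using intw by auto
    show "(\<lambda>x. w x * box_bump a b n x) \<in> borel_measurable (lebesgue_on ?C)" for n
      using intw meas by measurable
    show "AE x in lebesgue_on ?C. norm (w x * box_bump a b n x) \<le> norm (w x)" for n
      using box_bump_nonneg[of a b n] box_bump_le_1[of a b n]
      by (auto simp: abs_mult intro!: AE_I2 mult_left_le)
    \<comment> \<open>The bumps converge to the indicator of the open box, so on the sides of the
      closed box the limit would be wrong; these form a null set.\<close>
    have "cbox a b - box a b \<in> null_sets lebesgue"
      using negligible_frontier_interval negligible_iff_null_sets by blast
    then have "AE x in lebesgue. x \<notin> cbox a b - box a b"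
      by (rule AE_not_in)
    then show "AE x in lebesgue_on ?C. (\<lambda>n. w x * box_bump a b n x) \<longlonglongrightarrow> w x"
      unfolding AE_restrict_space_iff[of ?C lebesgue, simplified]
    proof (rule AE_mp, intro AE_I2 impI)
      fix x assume "x \<notin> cbox a b - box a b" "x \<in> cbox a b"
      then show "(\<lambda>n. w x * box_bump a b n x) \<longlonglongrightarrow> w x"
        using tendsto_mult[OF tendsto_const box_bump_tendsto[of a b x], of "w x"] by simp
    qed
  qed
  moreover have "(LINT x|lebesgue_on ?C. w x * box_bump a b n x) = 0" for n
  proof -
    have "(LINT x|lebesgue_on U. w x * box_bump a b n x) = (LINT x|lebesgue_on ?C. w x * box_bump a b n x)"
      by (rule integral_lebesgue_on_support(1)) (use ab bb0 \<open>open U\<close> in auto)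
    then show ?thesis
      using zero[OF test_fun_box_bump[OF ab]] by simp
  qed
  ultimately have "(LINT x|lebesgue_on ?C. w x) = 0"
    by (simp add: LIMSEQ_const_iff)
  then show ?thesis
    using lebesgue_integral_eq_integral[OF intw] by simp
qed

lemma fundamental_lemma:
  assumes "open U" and w: "loc_integrable_on U w"
    and zero: "\<And>\<phi>. test_fun U \<phi> \<Longrightarrow> (LINT x|lebesgue_on U. w x * \<phi> x) = 0"
  shows "AE x in lebesgue_on U. w x = (0::real)"
proof -
  have box: "negligible {x \<in> cbox c d. w x \<noteq> 0}" if cd: "cbox c d \<subseteq> U" for c d
  proof -
    \<comment> \<open>The differentiation theorem asks for integrability on every box, but
      \<open>w\<close> is integrable only on compact subsets of \<open>U\<close>; hence the
      cut-off.\<close>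
    define F where "F = (\<lambda>x. if x \<in> cbox c d then w x else 0)"
    have "w integrable_on cbox c d"
      using w cd by (intro integrable_on_lebesgue_on) (auto simp: loc_integrable_on_def)
    then have "F integrable_on UNIV"
      unfolding F_def by (simp add: integrable_restrict_UNIV)
    then have "F integrable_on cbox a b" for a b
      by (rule integrable_on_subcbox) simp
    then obtain N where N: "negligible N"
      "\<And>x e. \<lbrakk>x \<notin> N; 0 < e\<rbrakk> \<Longrightarrow> \<exists>\<delta>>0. \<forall>h. 0 < h \<and> h < \<delta> \<longrightarrow>
          norm (integral (cbox x (x + h *\<^sub>R One)) F /\<^sub>R h ^ DIM(pt) - F x) < e"
      using integrable_ccontinuous_explicit[of F] by metis
    have "w x = 0" if x: "x \<in> box c d" "x \<notin> N" for x
    proof (rule ccontr)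
      assume "w x \<noteq> 0"
      then obtain \<delta> where \<delta>: "\<delta> > 0" "\<And>h. 0 < h \<Longrightarrow> h < \<delta> \<Longrightarrow>
          norm (integral (cbox x (x + h *\<^sub>R One)) F /\<^sub>R h ^ DIM(pt) - F x) < norm (w x)"
        using N(2)[OF x(2), of "norm (w x)"] by auto
      obtain r where r: "r > 0" "ball x r \<subseteq> box c d"
        using x(1) open_contains_ball[of "box c d"] open_box by blast
      define q where "q = norm (One :: pt)"
      have q: "0 \<le> q" by (simp add: q_def)
      \<comment> \<open>The first bound makes the average over the cube of side \<open>h\<close>
        closer to \<open>F x\<close> than \<open>norm (w x)\<close>; the second gives
        \<open>h * q < r\<close>, which keeps the cube inside the ball around
        \<open>x\<close>.\<close>
      define h where "h = min (\<delta> / 2) (r / (2 * (q + 1)))"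
      have h: "0 < h" "h < \<delta>"
        using \<delta>(1) r(1) q by (auto simp: h_def)
      have sub: "cbox x (x + h *\<^sub>R One) \<subseteq> box c d"
      proof
        fix y assume y: "y \<in> cbox x (x + h *\<^sub>R One)"
        have "norm (y - x) \<le> norm (h *\<^sub>R (One::pt))"
        proof (rule norm_le_componentwise)
          fix b :: pt assume "b \<in> Basis"
          with y have "x \<bullet> b \<le> y \<bullet> b" "y \<bullet> b \<le> (x + h *\<^sub>R One) \<bullet> b"
            by (auto simp: mem_box)
          then show "\<bar>(y - x) \<bullet> b\<bar> \<le> \<bar>(h *\<^sub>R One) \<bullet> b\<bar>"
            by (auto simp: inner_diff_left inner_add_left)
        qed
        also have "\<dots> = h * q"
          using h by (simp add: q_def)
        also have "\<dots> \<le> r / (2 * (q + 1)) * q"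
          using q by (intro mult_right_mono) (auto simp: h_def)
        also have "\<dots> < r"
        proof -
          have "q / (2 * (q + 1)) < 1"
            using q by (simp add: divide_less_eq)
          then have "r * (q / (2 * (q + 1))) < r * 1"
            using r(1) by (rule mult_strict_left_mono)
          then show ?thesis by simp
        qed
        finally have "y \<in> ball x r"
          by (simp add: dist_norm norm_minus_commute)
        with r show "y \<in> box c d" by blast
      qed
      then have sub': "cbox x (x + h *\<^sub>R One) \<subseteq> cbox c d"
        using box_subset_cbox by blast
      have "integral (cbox x (x + h *\<^sub>R One)) F = integral (cbox x (x + h *\<^sub>R One)) w"
        by (rule integral_cong) (use sub' in \<open>auto simp: F_def\<close>)
      also have "\<dots> = 0"
        using sub' cd by (intro integral_cbox_zero_if_test_zero[OF assms]) auto
      \<comment> \<open>The average is 0, so the estimate compares \<open>F x\<close> with 0 and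
        contradicts \<open>F x = w x\<close>.\<close>
      finally have "norm (F x) < norm (w x)"
        using \<delta>(2)[OF h] by simp
      moreover have "x \<in> cbox c d"
        using x(1) box_subset_cbox by blast
      ultimately show False
        by (simp add: F_def)
    qed
    then have "{x \<in> cbox c d. w x \<noteq> 0} \<subseteq> N \<union> (cbox c d - box c d)"
      by blast
    with negligible_Un[OF N(1) negligible_frontier_interval] show ?thesis
      by (rule negligible_subset)
  qed
  obtain \<D> where \<D>: "countable \<D>" "\<D> \<subseteq> Pow U" "\<And>X. X \<in> \<D> \<Longrightarrow> \<exists>a b. X = cbox a b" "\<Union>\<D> = U"
    using open_countable_Union_open_cbox[OF \<open>open U\<close>] by metis
  have "{x \<in> U. w x \<noteq> 0} = \<Union>((\<lambda>X. {x \<in> X. w x \<noteq> 0}) ` \<D>)"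
    using \<D>(4) by blast
  moreover have "negligible \<dots>"
  proof (rule negligible_countable_Union)
    show "countable ((\<lambda>X. {x \<in> X. w x \<noteq> 0}) ` \<D>)"
      using \<D>(1) by simp
    fix S assume "S \<in> (\<lambda>X. {x \<in> X. w x \<noteq> 0}) ` \<D>"
    then obtain X where X: "X \<in> \<D>" "S = {x \<in> X. w x \<noteq> 0}"
      by blast
    then obtain a b where "X = cbox a b" "X \<subseteq> U"
      using \<D>(2,3) by blast
    with X(2) box show "negligible S"
      by simp
  qed
  ultimately have "negligible {x \<in> U. w x \<noteq> 0}"
    by (simp only:)
  then have "{x \<in> U. w x \<noteq> 0} \<in> null_sets lebesgue"
    by (rule negligible_iff_null_sets[THEN iffD1])
  then have "AE x in lebesgue. x \<notin> {x \<in> U. w x \<noteq> 0}"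
    by (rule AE_not_in)
  then show ?thesis
    using \<open>open U\<close> by (subst AE_restrict_space_iff) auto
qed

lemma loc_integrable_on_diff:
  "loc_integrable_on U u \<Longrightarrow> loc_integrable_on U v \<Longrightarrow> loc_integrable_on U (\<lambda>x. u x - v x)"
  by (auto simp: loc_integrable_on_def)

text \<open>A Bochner integral can be split only into integrable parts, so linearity of weak
  gradients depends on this. The compact support of \<open>\<phi>\<close> upgrades local
  integrability to integrability on \<open>U\<close>.\<close>

lemma is_weak_grad_integrable:
  assumes "open U" "is_weak_grad U v g" "test_fun U \<phi>"
  shows "integrable (lebesgue_on U) (\<lambda>x. v x * frechet_derivative \<phi> (at x) e)"
    and "integrable (lebesgue_on U) (\<lambda>x. (g x \<bullet> e) * \<phi> x)"
proof -
  obtain C where C: "compact C" "C \<subseteq> U" "C \<in> sets lebesgue" "\<And>x. x \<notin> C \<Longrightarrow> \<phi> x = 0"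
    "\<And>x e. x \<notin> C \<Longrightarrow> frechet_derivative \<phi> (at x) e = 0"
    using test_fun_support[OF assms(3)] by metis
  have s: "smooth \<phi>" using assms(3) by (simp add: test_fun_def)
  have "integrable (lebesgue_on U) (\<lambda>x. frechet_derivative \<phi> (at x) e *\<^sub>R v x)"
    using assms C s
    by (intro loc_integrable_mult_compact_support[where C=C])
      (auto simp: is_weak_grad_def intro: smooth_continuous smooth_frechet_derivative)
  then show "integrable (lebesgue_on U) (\<lambda>x. v x * frechet_derivative \<phi> (at x) e)"
    by (simp add: mult.commute)
  have "integrable (lebesgue_on U) (\<lambda>x. \<phi> x *\<^sub>R g x)"
    using assms C s
    by (intro loc_integrable_mult_compact_support[where C=C])
      (auto simp: is_weak_grad_def intro: smooth_continuous)
  then have "integrable (lebesgue_on U) (\<lambda>x. (\<phi> x *\<^sub>R g x) \<bullet> e)"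
    by (rule integrable_inner_left)
  then show "integrable (lebesgue_on U) (\<lambda>x. (g x \<bullet> e) * \<phi> x)"
    by (simp add: mult.commute)
qed

lemma is_weak_grad_diff:
  assumes "open U" "is_weak_grad U u g" "is_weak_grad U v g'"
  shows "is_weak_grad U (\<lambda>x. u x - v x) (\<lambda>x. g x - g' x)"
  unfolding is_weak_grad_def
proof (intro conjI allI impI)
  show "loc_integrable_on U (\<lambda>x. u x - v x)" "loc_integrable_on U (\<lambda>x. g x - g' x)"
    using assms by (auto simp: is_weak_grad_def intro: loc_integrable_on_diff)
  fix \<phi> e assume \<phi>: "test_fun U \<phi>"
  show "(LINT x|lebesgue_on U. (u x - v x) * frechet_derivative \<phi> (at x) e) =
      - (LINT x|lebesgue_on U. ((g x - g' x) \<bullet> e) * \<phi> x)"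
    using is_weak_grad_integrable[OF assms(1,2) \<phi>] is_weak_grad_integrable[OF assms(1,3) \<phi>]
      assms(2,3) \<phi>
    by (simp add: is_weak_grad_def left_diff_distrib inner_diff_left)
qed

text \<open>The difference is a weak gradient of the zero function, so each of its components is
  orthogonal to all test functions; finitely many exceptional null sets, one per basis vector, are
  combined.\<close>

lemma weak_grad_unique:
  assumes "open U" "is_weak_grad U v g" "is_weak_grad U v g'"
  shows "AE x in lebesgue_on U. g x = g' x"
proof -
  have "AE x in lebesgue_on U. (g x - g' x) \<bullet> e = 0" for e
  proof (rule fundamental_lemma[OF assms(1)])
    show "loc_integrable_on U (\<lambda>x. (g x - g' x) \<bullet> e)"
      using assms unfolding is_weak_grad_def loc_integrable_on_def by auto
    show "(LINT x|lebesgue_on U. ((g x - g' x) \<bullet> e) * \<phi> x) = 0" if "test_fun U \<phi>" for \<phi>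
      using is_weak_grad_diff[OF assms] that unfolding is_weak_grad_def by simp
  qed
  then have "AE x in lebesgue_on U. \<forall>e\<in>Basis. (g x - g' x) \<bullet> e = 0"
    by (simp add: AE_finite_all)
  then show ?thesis
  proof (rule AE_mp, intro AE_I2 impI)
    fix x assume "\<forall>e\<in>Basis. (g x - g' x) \<bullet> e = 0"
    then show "g x = g' x"
      using euclidean_all_zero_iff[of "g x - g' x"] by simp
  qed
qed

lemma is_weak_grad_grad: "is_weak_grad U v g \<Longrightarrow> is_weak_grad U v (grad U v)"
  unfolding grad_def by (rule someI[of "is_weak_grad U v"])

lemma grad_AE:
  "open U \<Longrightarrow> is_weak_grad U v g \<Longrightarrow> AE x in lebesgue_on U. grad U v x = g x"
  by (rule weak_grad_unique[OF _ is_weak_grad_grad])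


section \<open>Square-integrable functions and Poincare's inequality\<close>

text \<open>Completeness of Lebesgue measure: the preimages of a set under \<open>f\<close> and
  \<open>g\<close> differ only inside a null set, all of whose subsets are measurable.\<close>

lemma borel_measurable_lebesgue_on_cong_AE:
  fixes f g :: "'a::euclidean_space \<Rightarrow> 'b::euclidean_space"
  assumes f: "f \<in> borel_measurable (lebesgue_on U)" and "U \<in> sets lebesgue"
    and AE: "AE x in lebesgue_on U. f x = g x"
  shows "g \<in> borel_measurable (lebesgue_on U)"
proof (rule measurableI)
  fix A :: "'b set" assume A: "A \<in> sets borel"
  have "AE x in lebesgue. x \<in> U \<longrightarrow> f x = g x"
    using AE assms(2) by (simp add: AE_restrict_space_iff)
  then obtain N where N: "N \<in> null_sets lebesgue" "\<And>x. x \<in> U - N \<Longrightarrow> f x = g x"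
    by (rule AE_E3) auto
  have "f -` A \<inter> U \<in> sets (lebesgue_on U)"
    using measurable_sets[OF f A] by simp
  then have fA: "f -` A \<inter> U \<in> sets lebesgue"
    using assms(2) by (auto simp: sets_restrict_space_iff)
  have "N \<inter> (g -` A \<inter> U) \<in> null_sets lebesgue"
    using N(1) negligible_iff_null_sets negligible_subset[of N "N \<inter> (g -` A \<inter> U)"] by blast
  then have "(f -` A \<inter> U) - N \<union> (N \<inter> (g -` A \<inter> U)) \<in> sets lebesgue"
    using fA N(1) by auto
  moreover have "g -` A \<inter> U = (f -` A \<inter> U) - N \<union> (N \<inter> (g -` A \<inter> U))"
    using N(2) by auto
  ultimately have "g -` A \<inter> U \<in> sets lebesgue"
    by simp
  then show "g -` A \<inter> space (lebesgue_on U) \<in> sets (lebesgue_on U)"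
    using assms(2) by (auto simp: sets_restrict_space_iff)
qed simp

lemma L2_cong_AE:
  assumes "L2_on U v" "U \<in> sets lebesgue" "AE x in lebesgue_on U. v x = w x"
  shows "L2_on U w" "L2_norm U w = L2_norm U v"
proof -
  have v: "v \<in> borel_measurable (lebesgue_on U)"
    using assms(1) by (simp add: L2_on_def)
  have w: "w \<in> borel_measurable (lebesgue_on U)"
    by (rule borel_measurable_lebesgue_on_cong_AE[OF v assms(2,3)])
  have AE: "AE x in lebesgue_on U. (norm (v x))\<^sup>2 = (norm (w x))\<^sup>2"
    using assms(3) by (rule AE_mp) auto
  have "integrable (lebesgue_on U) (\<lambda>x. (norm (w x))\<^sup>2)"
    using assms(1) integrable_cong_AE[OF _ _ AE] v w by (simp add: L2_on_def)
  with w show "L2_on U w"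
    by (simp add: L2_on_def)
  show "L2_norm U w = L2_norm U v"
    unfolding L2_norm_def using integral_cong_AE[OF _ _ AE] v w by simp
qed

lemma L2_norm_nonneg: "0 \<le> L2_norm U v"
  by (simp add: L2_norm_def)

lemma L2_norm_power2: "(L2_norm U v)\<^sup>2 = (LINT x|lebesgue_on U. (norm (v x))\<^sup>2)"
  by (simp add: L2_norm_def)

lemma L2_on_norm: "L2_on U v \<Longrightarrow> L2_on U (\<lambda>x. norm (v x))"
  by (auto simp: L2_on_def)

lemma L2_norm_norm: "L2_norm U (\<lambda>x. norm (v x)) = L2_norm U v"
  by (simp add: L2_norm_def)

lemma L2_on_mult_integrable:
  fixes u v :: "pt \<Rightarrow> real"
  assumes "L2_on U u" "L2_on U v"
  shows "integrable (lebesgue_on U) (\<lambda>x. u x * v x)"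
proof (rule Bochner_Integration.integrable_bound)
  show "integrable (lebesgue_on U) (\<lambda>x. (norm (u x))\<^sup>2 + (norm (v x))\<^sup>2)"
    using assms by (auto simp: L2_on_def)
  show "(\<lambda>x. u x * v x) \<in> borel_measurable (lebesgue_on U)"
    using assms by (auto simp: L2_on_def)
  have "\<bar>a * b\<bar> \<le> a\<^sup>2 + b\<^sup>2" for a b :: real
  proof -
    have "2 * (\<bar>a\<bar> * \<bar>b\<bar>) \<le> a\<^sup>2 + b\<^sup>2"
      using sum_squares_bound[of "\<bar>a\<bar>" "\<bar>b\<bar>"] by simp
    moreover have "0 \<le> \<bar>a\<bar> * \<bar>b\<bar>"
      by simp
    ultimately show ?thesis
      unfolding abs_mult by linarith
  qed
  then show "AE x in lebesgue_on U. norm (u x * v x) \<le> norm ((norm (u x))\<^sup>2 + (norm (v x))\<^sup>2)"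
    by (auto intro!: AE_I2)
qed

lemma Cauchy_Schwarz_L2:
  fixes u v :: "pt \<Rightarrow> real"
  assumes "L2_on U u" "L2_on U v"
  shows "\<bar>LINT x|lebesgue_on U. u x * v x\<bar> \<le> L2_norm U u * L2_norm U v"
proof -
  let ?A = "LINT x|lebesgue_on U. (u x)\<^sup>2"
  let ?B = "LINT x|lebesgue_on U. u x * v x"
  let ?C = "LINT x|lebesgue_on U. (v x)\<^sup>2"
  have int: "integrable (lebesgue_on U) (\<lambda>x. (u x)\<^sup>2)" "integrable (lebesgue_on U) (\<lambda>x. (v x)\<^sup>2)"
    "integrable (lebesgue_on U) (\<lambda>x. u x * v x)"
    using assms L2_on_mult_integrable[OF assms] by (auto simp: L2_on_def)
  \<comment> \<open>The usual quadratic in \<open>t\<close>. For \<open>?C = 0\<close> it is affine,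
    and the value of \<open>t\<close> chosen below makes it -1 if \<open>?B\<close> is not 0;
    otherwise its minimizer \<open>?B / ?C\<close> gives the claim.\<close>
  have q: "0 \<le> ?A - 2 * t * ?B + t\<^sup>2 * ?C" for t
  proof -
    have "0 \<le> (LINT x|lebesgue_on U. (u x - t * v x)\<^sup>2)"
      by simp
    also have "(\<lambda>x. (u x - t * v x)\<^sup>2) = (\<lambda>x. (u x)\<^sup>2 - 2 * t * (u x * v x) + t\<^sup>2 * (v x)\<^sup>2)"
      by (auto simp: power2_eq_square algebra_simps)
    finally show ?thesis
      using int by simp
  qed
  have "?B\<^sup>2 \<le> ?A * ?C"
  proof (cases "?C = 0")
    case True
    have "?B = 0"
    proof (rule ccontr)
      assume "?B \<noteq> 0"
      then show False
        using q[of "(?A + 1) / (2 * ?B)"] True by (simp add: field_simps)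
    qed
    with True show ?thesis by simp
  next
    case False
    then have "?C > 0"
      by (simp add: less_le)
    then show ?thesis
      using q[of "?B / ?C"] by (simp add: field_simps power2_eq_square)
  qed
  then have "sqrt (?B\<^sup>2) \<le> sqrt (?A * ?C)"
    by (rule real_sqrt_le_mono)
  then show ?thesis
    by (simp add: L2_norm_def real_sqrt_mult)
qed

text \<open>Minkowski's inequality under a pointwise bound instead of an equation, so that it serves
  sums, differences and triangle estimates alike.\<close>

lemma L2_on_le:
  fixes w :: "pt \<Rightarrow> 'c::euclidean_space"
  assumes u: "L2_on U u" and v: "L2_on U v" and w: "w \<in> borel_measurable (lebesgue_on U)"
    and le: "\<And>x. x \<in> U \<Longrightarrow> norm (w x) \<le> norm (u x) + norm (v x)"
  shows "L2_on U w" "L2_norm U w \<le> L2_norm U u + L2_norm U v"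
proof -
  let ?g = "\<lambda>x. (norm (u x))\<^sup>2 + 2 * (norm (u x) * norm (v x)) + (norm (v x))\<^sup>2"
  have int: "integrable (lebesgue_on U) (\<lambda>x. (norm (u x))\<^sup>2)"
    "integrable (lebesgue_on U) (\<lambda>x. (norm (v x))\<^sup>2)"
    "integrable (lebesgue_on U) (\<lambda>x. norm (u x) * norm (v x))"
    using u v L2_on_mult_integrable[OF L2_on_norm[OF u] L2_on_norm[OF v]] by (auto simp: L2_on_def)
  then have intg: "integrable (lebesgue_on U) ?g"
    by auto
  have le2: "(norm (w x))\<^sup>2 \<le> ?g x" if "x \<in> U" for x
    using power_mono[OF le[OF that], of 2] by (simp add: power2_sum)
  have intw: "integrable (lebesgue_on U) (\<lambda>x. (norm (w x))\<^sup>2)"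
  proof (rule Bochner_Integration.integrable_bound[OF intg])
    show "(\<lambda>x. (norm (w x))\<^sup>2) \<in> borel_measurable (lebesgue_on U)"
      using w by measurable
    show "AE x in lebesgue_on U. norm ((norm (w x))\<^sup>2) \<le> norm (?g x)"
      using le2 by (auto intro!: AE_I2 order_trans[OF _ abs_ge_self])
  qed
  with w show "L2_on U w"
    by (simp add: L2_on_def)
  have "(L2_norm U w)\<^sup>2 \<le> (LINT x|lebesgue_on U. ?g x)"
    unfolding L2_norm_power2 by (rule integral_mono[OF intw intg]) (use le2 in simp)
  also have "\<dots> = (L2_norm U u)\<^sup>2 + 2 * (LINT x|lebesgue_on U. norm (u x) * norm (v x)) + (L2_norm U v)\<^sup>2"
    using int by (simp add: L2_norm_power2)
  also have "\<dots> \<le> (L2_norm U u)\<^sup>2 + 2 * (L2_norm U u * L2_norm U v) + (L2_norm U v)\<^sup>2"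
    using Cauchy_Schwarz_L2[OF L2_on_norm[OF u] L2_on_norm[OF v]] by (simp add: L2_norm_norm)
  also have "\<dots> = (L2_norm U u + L2_norm U v)\<^sup>2"
    by (simp add: power2_sum)
  finally show "L2_norm U w \<le> L2_norm U u + L2_norm U v"
    by (rule power2_le_imp_le) (simp add: L2_norm_nonneg)
qed

lemma L2_on_diff:
  assumes "L2_on U u" "L2_on U v"
  shows "L2_on U (\<lambda>x. u x - v x)"
  by (rule L2_on_le(1)[OF assms]) (use assms in \<open>auto simp: L2_on_def norm_triangle_ineq4\<close>)

lemma L2_on_compact_support:
  assumes "continuous_on UNIV v" "compact C" "C \<subseteq> U" "open U" "\<And>x. x \<notin> C \<Longrightarrow> v x = 0"
  shows "L2_on U v"
proof -
  have C: "C \<in> sets lebesgue"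
    using assms(2) by (simp add: borel_compact)
  have "integrable (lebesgue_on C) (\<lambda>x. (norm (v x))\<^sup>2)"
    by (rule integrable_lebesgue_on_compact[OF assms(2)])
      (auto intro!: continuous_intros continuous_on_subset[OF assms(1)])
  then have "integrable (lebesgue_on U) (\<lambda>x. (norm (v x))\<^sup>2)"
    using integral_lebesgue_on_support(2)[of C U "\<lambda>x. (norm (v x))\<^sup>2"] assms C by simp
  moreover have "v \<in> borel_measurable (lebesgue_on U)"
    using assms(4) by (intro continuous_imp_measurable_on_sets_lebesgue continuous_on_subset[OF assms(1)]) auto
  ultimately show ?thesis
    by (simp add: L2_on_def)
qed

lemma L2_norm_compact_support:
  assumes "compact C" "C \<subseteq> U" "U \<in> sets lebesgue" "\<And>x. x \<notin> C \<Longrightarrow> v x = 0"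
  shows "L2_norm U v = L2_norm C v"
  unfolding L2_norm_def
  using integral_lebesgue_on_support(1)[of C U "\<lambda>x. (norm (v x))\<^sup>2"] assms
  by (simp add: borel_compact)

text \<open>\<open>H1\<close> provides some square-integrable weak gradient; the chosen
  \<open>grad U v\<close> inherits the property because it agrees with that one almost
  everywhere.\<close>

lemma H1_grad:
  assumes "open U" "v \<in> H1 U"
  shows "L2_on U v" "is_weak_grad U v (grad U v)" "L2_on U (grad U v)"
proof -
  obtain g where g: "L2_on U v" "is_weak_grad U v g" "L2_on U g"
    using assms(2) by (auto simp: H1_def)
  then show "L2_on U v" "is_weak_grad U v (grad U v)"
    by (auto intro: is_weak_grad_grad)
  have "AE x in lebesgue_on U. g x = grad U v x"
    using weak_grad_unique[OF assms(1) g(2)] is_weak_grad_grad[OF g(2)] by blast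
  with g(3) assms(1) show "L2_on U (grad U v)"
    by (auto intro: L2_cong_AE(1))
qed

lemma H1_semi_eq:
  assumes "open U" "is_weak_grad U u g" "L2_on U g"
  shows "H1_semi U u = L2_norm U g"
  unfolding H1_semi_def
  by (rule L2_cong_AE(2)) (use assms weak_grad_unique is_weak_grad_grad in \<open>auto\<close>)

text \<open>The last two facts are extension by zero for test functions: a function and its gradient
  that vanish off a compact subset of \<open>U\<close> have the same norms over \<open>U\<close> and
  over any larger open set.\<close>

lemma test_fun_smooth_grad:
  assumes "test_fun U \<phi>" "open U"
  shows "is_weak_grad U \<phi> (smooth_grad \<phi>)" "L2_on U \<phi>" "L2_on U (smooth_grad \<phi>)"
    and "U \<subseteq> W \<Longrightarrow> open W \<Longrightarrow> L2_norm W \<phi> = L2_norm U \<phi>"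
    and "U \<subseteq> W \<Longrightarrow> open W \<Longrightarrow> L2_norm W (smooth_grad \<phi>) = L2_norm U (smooth_grad \<phi>)"
proof -
  obtain C where C: "compact C" "C \<subseteq> U" "\<And>x. x \<notin> C \<Longrightarrow> \<phi> x = 0"
    "\<And>x e. x \<notin> C \<Longrightarrow> frechet_derivative \<phi> (at x) e = 0"
    using test_fun_support[OF assms(1)] by metis
  have C0: "smooth_grad \<phi> x = 0" if "x \<notin> C" for x
    using C(4)[OF that] by (simp add: smooth_grad_def)
  have s: "smooth \<phi>" using assms(1) by (simp add: test_fun_def)
  show "is_weak_grad U \<phi> (smooth_grad \<phi>)"
    using assms s by (intro is_weak_grad_smooth)
  show "L2_on U \<phi>"
    by (rule L2_on_compact_support[OF smooth_continuous[OF s] C(1,2) assms(2) C(3)])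
  show "L2_on U (smooth_grad \<phi>)"
    by (rule L2_on_compact_support[OF continuous_smooth_grad[OF s] C(1,2) assms(2) C0])
  assume W: "U \<subseteq> W" "open W"
  then have CW: "C \<subseteq> W" "W \<in> sets lebesgue" "U \<in> sets lebesgue"
    using C(2) assms(2) by auto
  show "L2_norm W \<phi> = L2_norm U \<phi>"
    using L2_norm_compact_support[OF C(1) CW(1,2) C(3)] L2_norm_compact_support[OF C(1,2) CW(3) C(3)]
    by simp
  show "L2_norm W (smooth_grad \<phi>) = L2_norm U (smooth_grad \<phi>)"
    using L2_norm_compact_support[OF C(1) CW(1,2) C0] L2_norm_compact_support[OF C(1,2) CW(3) C0]
    by simp
qed

lemma test_fun_H10:
  assumes "test_fun U \<phi>" "open U"
  shows "\<phi> \<in> H10 U"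
proof -
  have "\<phi> \<in> H1 U"
    using test_fun_smooth_grad[OF assms] by (auto simp: H1_def)
  moreover have "H1_norm U (\<lambda>x. \<phi> x - \<phi> x) = 0"
  proof -
    \<comment> \<open>Even for the zero function \<open>grad\<close> is only some weak gradient, so
      the vanishing of its seminorm has to go through uniqueness.\<close>
    have "is_weak_grad U (\<lambda>x. 0) (\<lambda>x. 0)"
      by (simp add: is_weak_grad_def loc_integrable_on_def)
    moreover have "L2_on U (\<lambda>x. 0::pt)"
      by (simp add: L2_on_def)
    ultimately have "H1_semi U (\<lambda>x. 0) = L2_norm U (\<lambda>x. 0::pt)"
      by (rule H1_semi_eq[OF assms(2)])
    then show ?thesis
      by (simp add: H1_norm_def L2_norm_def)
  qed
  ultimately show ?thesis
    using assms(1) unfolding H10_def by (auto intro!: exI[of _ "\<lambda>_. \<phi>"])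
qed

text \<open>Poincare's inequality passes to subdomains: it holds for test functions, as these belong to
  both spaces, and extends by density.\<close>

lemma poincare_subdomain:
  assumes "open U" "open W" "U \<subseteq> W" "poincare_const W C" "v \<in> H10 U"
  shows "L2_norm U v \<le> C * H1_semi U v"
proof -
  obtain \<phi> where \<phi>: "\<And>n. test_fun U (\<phi> n)"
    and lim: "(\<lambda>n. H1_norm U (\<lambda>x. \<phi> n x - v x)) \<longlonglongrightarrow> 0" and v: "v \<in> H1 U"
    using assms(5) by (auto simp: H10_def)
  have C: "0 < C" using assms(4) by (simp add: poincare_const_def)
  let ?e = "\<lambda>n. H1_norm U (\<lambda>x. \<phi> n x - v x)"
  \<comment> \<open>Passing from \<open>v\<close> to \<open>\<phi> n\<close> costs
    \<open>?e n\<close> twice: once in the gradient, where it is multiplied by \<open>C\<close>, and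
    once in the function itself.\<close>
  have bound: "L2_norm U v \<le> C * (H1_semi U v + ?e n) + ?e n" for n
  proof -
    note vg = H1_grad[OF assms(1) v]
    note t = test_fun_smooth_grad[OF \<phi>[of n] assms(1)]
    let ?d = "\<lambda>x. \<phi> n x - v x" and ?g = "\<lambda>x. smooth_grad (\<phi> n) x - grad U v x"
    have tW: "test_fun W (\<phi> n)"
      using \<phi>[of n] assms(3) unfolding test_fun_def by blast
    have dL2: "L2_on U ?d" "L2_on U ?g"
      using t(2,3) vg(1,3) by (auto intro: L2_on_diff)
    have semi: "H1_semi U ?d = L2_norm U ?g"
      by (rule H1_semi_eq[OF assms(1) is_weak_grad_diff[OF assms(1) t(1) vg(2)] dL2(2)])
    have e: "L2_norm U ?d \<le> ?e n" "L2_norm U ?g \<le> ?e n"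
      unfolding H1_norm_def semi by (auto simp: L2_norm_nonneg)
    have "L2_norm U (\<phi> n) = L2_norm W (\<phi> n)"
      using t(4)[OF assms(3,2)] by simp
    also have "\<dots> \<le> C * H1_semi W (\<phi> n)"
      using assms(4) test_fun_H10[OF tW assms(2)] by (simp add: poincare_const_def)
    also have "H1_semi W (\<phi> n) = L2_norm U (smooth_grad (\<phi> n))"
      using H1_semi_eq[OF assms(2) test_fun_smooth_grad(1,3)[OF tW assms(2)]] t(5)[OF assms(3,2)] by simp
    also have "\<dots> \<le> H1_semi U v + ?e n"
    proof -
      have "L2_norm U (smooth_grad (\<phi> n)) \<le> L2_norm U (grad U v) + L2_norm U ?g"
        by (rule L2_on_le(2)[OF vg(3) dL2(2)])
          (use t(3) in \<open>auto simp: L2_on_def intro: norm_triangle_sub\<close>)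
      with e show ?thesis by (simp add: H1_semi_def)
    qed
    finally have 1: "L2_norm U (\<phi> n) \<le> C * (H1_semi U v + ?e n)"
      using C by simp
    have "L2_norm U v \<le> L2_norm U (\<phi> n) + L2_norm U ?d"
    proof (rule L2_on_le(2)[OF t(2) dL2(1)])
      show "v \<in> borel_measurable (lebesgue_on U)"
        using vg(1) by (simp add: L2_on_def)
    qed (unfold real_norm_def, arith)
    with 1 e show ?thesis by simp
  qed
  have "(\<lambda>n. C * (H1_semi U v + ?e n) + ?e n) \<longlonglongrightarrow> C * (H1_semi U v + 0) + 0"
    by (intro tendsto_intros lim)
  then have "L2_norm U v \<le> C * (H1_semi U v + 0) + 0"
    using bound by (intro LIMSEQ_le_const) auto
  then show ?thesis by simp
qed


section \<open>The polynomial projection on a cell\<close>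

text \<open>Completeness transfers measurability between the two sides, and if neither is integrable
  both integrals have the default value 0. Integrands can therefore be replaced before anything is
  known about them.\<close>

lemma lebesgue_on_cong_AE:
  fixes f g :: "'a::euclidean_space \<Rightarrow> 'b::euclidean_space"
  assumes "U \<in> sets lebesgue" "AE x in lebesgue_on U. f x = g x"
  shows "integrable (lebesgue_on U) f \<longleftrightarrow> integrable (lebesgue_on U) g"
    and "integral\<^sup>L (lebesgue_on U) f = integral\<^sup>L (lebesgue_on U) g"
proof -
  have AE': "AE x in lebesgue_on U. g x = f x"
    using assms(2) by (rule AE_mp) auto
  note m = borel_measurable_lebesgue_on_cong_AE[OF _ assms(1) assms(2)]
    borel_measurable_lebesgue_on_cong_AE[OF _ assms(1) AE']
  have *: "integrable (lebesgue_on U) f \<longleftrightarrow> integrable (lebesgue_on U) g"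
    using m integrable_cong_AE[OF _ _ assms(2)] borel_measurable_integrable by blast
  then show "integrable (lebesgue_on U) f \<longleftrightarrow> integrable (lebesgue_on U) g" .
  show "integral\<^sup>L (lebesgue_on U) f = integral\<^sup>L (lebesgue_on U) g"
  proof (cases "integrable (lebesgue_on U) f")
    case True
    with m show ?thesis
      by (intro integral_cong_AE[OF _ _ assms(2)]) auto
  next
    case False
    with * show ?thesis
      by (simp add: not_integrable_integral_eq)
  qed
qed

text \<open>The frontier of a convex set is a null set. This is the bridge from the forms, which
  integrate over \<open>E\<close>, to the norms and weak gradients on
  \<open>interior E\<close>.\<close>

lemma integral_interior_convex:
  fixes f :: "'a::euclidean_space \<Rightarrow> 'b::euclidean_space"
  assumes "convex E" "compact E"
  shows "integral\<^sup>L (lebesgue_on E) f = integral\<^sup>L (lebesgue_on (interior E)) f"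
proof -
  have E: "E \<in> sets lebesgue"
    using assms(2) by (simp add: borel_compact)
  have "frontier E \<in> null_sets lebesgue"
    using negligible_convex_frontier[OF assms(1)] by (rule negligible_iff_null_sets[THEN iffD1])
  then have "AE x in lebesgue. x \<notin> frontier E"
    by (rule AE_not_in)
  then have "AE x in lebesgue_on UNIV. indicator E x *\<^sub>R f x = indicator (interior E) x *\<^sub>R f x"
    unfolding lebesgue_on_UNIV_eq
  proof (rule AE_mp, intro AE_I2 impI)
    fix x assume "x \<notin> frontier E"
    then show "indicator E x *\<^sub>R f x = indicator (interior E) x *\<^sub>R f x"
      using interior_subset[of E] closure_subset[of E] by (auto simp: frontier_def indicator_def)
  qed
  then have "(LINT x|lebesgue_on UNIV. indicator E x *\<^sub>R f x) =
      (LINT x|lebesgue_on UNIV. indicator (interior E) x *\<^sub>R f x)"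
    by (intro lebesgue_on_cong_AE(2)) auto
  then show ?thesis
    using E by (simp add: integral_restrict_space lebesgue_on_UNIV_eq)
qed

lemma L2_on_subset:
  assumes "L2_on U v" "V \<subseteq> U" "U \<in> sets lebesgue" "V \<in> sets lebesgue"
  shows "L2_on V v"
proof -
  have "v \<in> borel_measurable (lebesgue_on V)"
    using assms by (auto simp: L2_on_def intro: measurable_restrict_mono)
  moreover have "integrable lebesgue (\<lambda>x. indicator V x *\<^sub>R (indicator U x *\<^sub>R (norm (v x))\<^sup>2))"
  proof (rule integrable_mult_indicator)
    show "integrable lebesgue (\<lambda>x. indicator U x *\<^sub>R (norm (v x))\<^sup>2)"
      using assms(1,3) by (simp add: L2_on_def integrable_restrict_space)
  qed (use assms(4) in simp)
  moreover have "(\<lambda>x. indicator V x *\<^sub>R (indicator U x *\<^sub>R (norm (v x))\<^sup>2)) = (\<lambda>x. indicator V x *\<^sub>R (norm (v x))\<^sup>2)"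
    using assms(2) by (auto simp: indicator_def fun_eq_iff)
  ultimately show ?thesis
    using assms(4) by (simp add: L2_on_def integrable_restrict_space)
qed

text \<open>The bound \<open>t \<le> 1 + t\<^sup>2\<close> suffices because constants are integrable
  on a set of finite measure. It is applied to gradients on cells and to traces on edges.\<close>

lemma square_integrable_imp_integrable:
  fixes v :: "'a::euclidean_space \<Rightarrow> 'b::euclidean_space"
  assumes "U \<in> lmeasurable" "v \<in> borel_measurable (lebesgue_on U)"
    "integrable (lebesgue_on U) (\<lambda>x. (norm (v x))\<^sup>2)"
  shows "integrable (lebesgue_on U) v"
proof (rule Bochner_Integration.integrable_bound[OF _ assms(2)])
  interpret finite_measure "lebesgue_on U"
    by (rule finite_measure_lebesgue_on[OF assms(1)])
  show "integrable (lebesgue_on U) (\<lambda>x. 1 + (norm (v x))\<^sup>2)"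
    using assms(3) by simp
  have "t \<le> 1 + t\<^sup>2" for t :: real
    using sum_squares_bound[of t 1] by (cases "t \<ge> 0") (auto, smt (verit) zero_le_power2)
  then show "AE x in lebesgue_on U. norm (v x) \<le> norm (1 + (norm (v x))\<^sup>2)"
    by (auto intro!: AE_I2 order_trans[OF _ abs_ge_self])
qed

text \<open>Taken as an integral of 1, the length automatically refers to the end points chosen in
  \<open>edge_integral\<close>.\<close>

definition edge_length :: "pt set \<Rightarrow> real" where
  "edge_length e = edge_integral e (\<lambda>x. 1)"

context
  fixes E e :: "pt set"
  assumes E: "polytope E" and e: "e \<in> edges E"
begin

text \<open>A face of dimension 1 of a polytope is compact, convex and collinear, hence a segment,
  so the choice in \<open>edge_integral\<close> has a witness. The end points obtained are the
  chosen ones and serve all integrands at once.\<close>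

lemma edge_segment:
  obtains a b where "e = closed_segment a b" "a \<noteq> b"
    "\<And>g. edge_integral e g = dist a b * (LINT t|lebesgue_on {0..1}. g (linepath a b t))"
proof -
  have dim: "e face_of E" "aff_dim e = 1"
    using e by (auto simp: edges_def edge_of_def)
  have "e \<noteq> {}"
    using dim(2) by auto
  moreover have "compact e"
    using E dim(1) face_of_imp_compact polytope_imp_compact polytope_imp_convex by blast
  moreover have "convex e"
    using dim(1) by (rule face_of_imp_convex)
  moreover have "collinear e"
    using dim(2) by (simp add: collinear_aff_dim)
  ultimately obtain a0 b0 where "e = closed_segment a0 b0"
    by (rule compact_convex_collinear_segment)
  then have ex: "\<exists>p. case p of (a, b) \<Rightarrow> e = closed_segment a b"
    by auto
  obtain a b where ab: "(SOME (a, b). e = closed_segment a b) = (a, b)"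
    by fastforce
  have seg: "e = closed_segment a b"
    using someI_ex[OF ex] ab by simp
  then have "a \<noteq> b"
    using dim(2) by auto
  with seg show ?thesis
    by (rule that) (simp add: edge_integral_def ab)
qed

lemma edge_length_pos: "0 < edge_length e"
proof -
  obtain a b where "a \<noteq> b"
    "\<And>g. edge_integral e g = dist a b * (LINT t|lebesgue_on {0..1}. g (linepath a b t))"
    using edge_segment by metis
  then show ?thesis
    by (simp add: edge_length_def measure_restrict_space)
qed

text \<open>It isolates the dependence on \<open>c\<close>, which is affine with slope minus the
  length. Summed over the edges, this makes the boundary condition of \<open>Pi_grad\<close> a
  solvable scalar equation for \<open>c\<close>.\<close>

lemma edge_integral_diff_const:
  assumes "L2_boundary E g"
  shows "edge_integral e (\<lambda>x. g x - (c + d \<bullet> x)) = edge_integral e (\<lambda>x. g x - d \<bullet> x) - c * edge_length e"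
proof -
  obtain a b where ab: "e = closed_segment a b"
    "\<And>g. edge_integral e g = dist a b * (LINT t|lebesgue_on {0..1}. g (linepath a b t))"
    using edge_segment by metis
  let ?l = "linepath a b"
  have int1: "integrable (lebesgue_on {0..1}) (\<lambda>t. g (?l t))"
    by (rule square_integrable_imp_integrable)
      (use assms e ab(1) in \<open>auto simp: L2_boundary_def\<close>)
  have int2: "integrable (lebesgue_on {0..1}) (\<lambda>t. d \<bullet> ?l t)"
    by (intro continuous_imp_integrable_real continuous_intros)
  have int3: "integrable (lebesgue_on {0..1::real}) (\<lambda>t. c)"
    by (intro continuous_imp_integrable_real continuous_intros)
  have "(LINT t|lebesgue_on {0..1}. g (?l t) - (c + d \<bullet> ?l t)) =
      (LINT t|lebesgue_on {0..1}. g (?l t)) - ((LINT t|lebesgue_on {0..1::real}. c) + (LINT t|lebesgue_on {0..1}. d \<bullet> ?l t))"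
    using int1 int2 int3 by (simp only: Bochner_Integration.integral_diff Bochner_Integration.integral_add
        Bochner_Integration.integrable_add)
  moreover have "(LINT t|lebesgue_on {0..1}. g (?l t) - d \<bullet> ?l t) =
      (LINT t|lebesgue_on {0..1}. g (?l t)) - (LINT t|lebesgue_on {0..1}. d \<bullet> ?l t)"
    using int1 int2 int3 by (simp only: Bochner_Integration.integral_diff)
  ultimately show ?thesis
    by (simp only: edge_length_def ab(2)) (simp add: measure_restrict_space right_diff_distrib distrib_left)
qed

end

lemma finite_edges: "polytope E \<Longrightarrow> finite (edges E)"
  using finite_subset[OF _ finite_polytope_faces[of E]] by (auto simp: edges_def edge_of_def)

lemma boundary_integral_diff_const:
  assumes "polytope E" "L2_boundary E g"
  shows "boundary_integral E (\<lambda>x. g x - (c + d \<bullet> x)) =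
    boundary_integral E (\<lambda>x. g x - d \<bullet> x) - c * (\<Sum>e\<in>edges E. edge_length e)"
  using edge_integral_diff_const[OF assms(1) _ assms(2)]
  by (simp add: boundary_integral_def sum_subtractf sum_distrib_left)

text \<open>A polytope with nonempty interior has a facet, which in the plane is an edge; a single
  edge of positive length is enough.\<close>

lemma perimeter_pos:
  assumes "polytope E" "interior E \<noteq> {}"
  shows "0 < (\<Sum>e\<in>edges E. edge_length e)"
proof -
  have dim: "aff_dim E = 2"
    using aff_dim_nonempty_interior[OF assms(2)] by simp
  with assms(1) obtain F where "F facet_of E"
    using polytope_facet_exists[of E] by auto
  then have "F \<in> edges E"
    using dim by (simp add: facet_of_def edges_def edge_of_def)
  then show ?thesis
    using assms(1) by (intro sum_pos finite_edges edge_length_pos) auto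
qed

lemma grad_affine_AE:
  assumes "open U"
  shows "AE x in lebesgue_on U. grad U (\<lambda>x. c + d \<bullet> x) x = d"
    and "v \<in> H1 U \<Longrightarrow> AE x in lebesgue_on U. grad U (\<lambda>y. v y - (c + d \<bullet> y)) x = grad U v x - d"
proof -
  have "smooth_grad (\<lambda>x. c + d \<bullet> x) x \<bullet> e = d \<bullet> e" for x e
    by (simp add: inner_smooth_grad smooth_affine frechet_derivative_affine)
  then have "smooth_grad (\<lambda>x. c + d \<bullet> x) = (\<lambda>x. d)"
    by (intro ext) (metis vector_eq_rdot)
  then have d: "is_weak_grad U (\<lambda>x. c + d \<bullet> x) (\<lambda>x. d)"
    using is_weak_grad_smooth[OF assms smooth_affine, of c d] by simp
  then show "AE x in lebesgue_on U. grad U (\<lambda>x. c + d \<bullet> x) x = d"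
    by (rule grad_AE[OF assms])
  assume "v \<in> H1 U"
  then show "AE x in lebesgue_on U. grad U (\<lambda>y. v y - (c + d \<bullet> y)) x = grad U v x - d"
    using is_weak_grad_diff[OF assms H1_grad(2)[OF assms] d] by (intro grad_AE[OF assms])
qed

text \<open>The gradient of \<open>Pi_grad E v\<close> has to be the mean of the gradient of \<open>v\<close>; the additive constant
  is then fixed by the boundary condition because the perimeter does not vanish.\<close>

lemma Pi_grad_P1:
  assumes E: "polytope E" "interior E \<noteq> {}" and v: "v \<in> vem_local E"
  shows "Pi_grad E v \<in> P1"
proof -
  let ?I = "interior E"
  let ?g = "trace_on E v"
  let ?L = "\<Sum>e\<in>edges E. edge_length e"
  define G where "G = (LINT x|lebesgue_on ?I. grad ?I v x)"
  define m where "m = measure lebesgue ?I"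
  define d0 where "d0 = G /\<^sub>R m"
  define c0 where "c0 = boundary_integral E (\<lambda>x. ?g x - d0 \<bullet> x) / ?L"
  have cE: "compact E" "convex E"
    using E(1) by (auto simp: polytope_imp_compact polytope_imp_convex)
  have I: "?I \<in> lmeasurable"
    using cE by (simp add: compact_imp_bounded lmeasurable_interior)
  have "\<not> negligible ?I"
    using open_not_negligible[OF open_interior E(2)] .
  then have m: "m > 0"
    using I by (simp add: m_def negligible_iff_measure0 less_le)
  have vH: "v \<in> H1 ?I" and tr: "\<exists>g. is_trace E v g"
    using v by (auto simp: vem_local_def)
  \<comment> \<open>The piecewise affine trace demanded in \<open>vem_local\<close> witnesses the
    choice made in \<open>trace_on\<close>.\<close>
  have "is_trace E v ?g"
    unfolding trace_on_def by (rule someI_ex[OF tr])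
  then have gL2: "L2_boundary E ?g"
    by (simp add: is_trace_def)
  have intG: "integrable (lebesgue_on ?I) (grad ?I v)"
    by (rule square_integrable_imp_integrable[OF I])
      (use H1_grad(3)[OF open_interior vH] in \<open>simp_all add: L2_on_def\<close>)
  interpret finite_measure "lebesgue_on ?I"
    by (rule finite_measure_lebesgue_on[OF I])
  have L: "?L > 0"
    by (rule perimeter_pos[OF E])
  \<comment> \<open>Gradients of affine functions are constant, so the orthogonality condition
    becomes linear algebra: the vector \<open>G - m *\<^sub>R d\<close> must be orthogonal to every
    \<open>d'\<close>.\<close>
  have orth: "(LINT x|lebesgue_on E. grad ?I (\<lambda>y. v y - (c + d \<bullet> y)) x \<bullet> grad ?I (\<lambda>x. c' + d' \<bullet> x) x)
      = (G - m *\<^sub>R d) \<bullet> d'" for c d c' d'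
  proof -
    have "(LINT x|lebesgue_on E. grad ?I (\<lambda>y. v y - (c + d \<bullet> y)) x \<bullet> grad ?I (\<lambda>x. c' + d' \<bullet> x) x)
      = (LINT x|lebesgue_on ?I. grad ?I (\<lambda>y. v y - (c + d \<bullet> y)) x \<bullet> grad ?I (\<lambda>x. c' + d' \<bullet> x) x)"
      by (rule integral_interior_convex[OF cE(2,1)])
    also have "\<dots> = (LINT x|lebesgue_on ?I. (grad ?I v x - d) \<bullet> d')"
    proof (rule lebesgue_on_cong_AE(2))
      show "AE x in lebesgue_on ?I. grad ?I (\<lambda>y. v y - (c + d \<bullet> y)) x \<bullet> grad ?I (\<lambda>x. c' + d' \<bullet> x) x
          = (grad ?I v x - d) \<bullet> d'"
        using grad_affine_AE(2)[OF open_interior vH, of c d] grad_affine_AE(1)[OF open_interior, of E c' d']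
        by eventually_elim simp
    qed auto
    also have "\<dots> = (LINT x|lebesgue_on ?I. grad ?I v x - d) \<bullet> d'"
      using intG by (intro integral_inner_left) auto
    also have "(LINT x|lebesgue_on ?I. grad ?I v x - d) = G - m *\<^sub>R d"
      using intG I by (simp add: G_def m_def measure_restrict_space)
    finally show ?thesis .
  qed
  have P1I: "(\<lambda>x. c + d \<bullet> x) \<in> P1" for c d
    by (auto simp: P1_def)
  have P1_all: "(\<forall>q\<in>P1. Z q) \<longleftrightarrow> (\<forall>c d. Z (\<lambda>x. c + d \<bullet> x))" for Z
    by (auto simp: P1_def)
  \<comment> \<open>An equivalence, so that it gives existence from right to left and uniqueness
    from left to right.\<close>
  have cond: "(\<forall>q\<in>P1. (LINT x|lebesgue_on E. grad ?I (\<lambda>y. v y - (c + d \<bullet> y)) x \<bullet> grad ?I q x) = 0) \<and>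
      boundary_integral E (\<lambda>x. ?g x - (c + d \<bullet> x)) = 0 \<longleftrightarrow> d = d0 \<and> c = c0" for c d
  proof -
    have "(\<forall>q\<in>P1. (LINT x|lebesgue_on E. grad ?I (\<lambda>y. v y - (c + d \<bullet> y)) x \<bullet> grad ?I q x) = 0) \<longleftrightarrow>
        (\<forall>d'. (G - m *\<^sub>R d) \<bullet> d' = 0)"
      unfolding P1_all orth by simp
    also have "\<dots> \<longleftrightarrow> G - m *\<^sub>R d = 0"
      by (metis inner_eq_zero_iff inner_zero_left)
    also have "\<dots> \<longleftrightarrow> d = d0"
      using m by (auto simp: d0_def)
    finally have 1: "(\<forall>q\<in>P1. (LINT x|lebesgue_on E. grad ?I (\<lambda>y. v y - (c + d \<bullet> y)) x \<bullet> grad ?I q x) = 0)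
        \<longleftrightarrow> d = d0" .
    have "boundary_integral E (\<lambda>x. ?g x - (c + d0 \<bullet> x)) = 0 \<longleftrightarrow> c = c0"
      unfolding boundary_integral_diff_const[OF E(1) gL2] c0_def using L by (auto simp: field_simps)
    with 1 show ?thesis by auto
  qed
  let ?Q = "\<lambda>p. p \<in> P1 \<and> (\<forall>q\<in>P1. (LINT x|lebesgue_on E. grad ?I (\<lambda>y. v y - p y) x \<bullet> grad ?I q x) = 0) \<and>
      boundary_integral E (\<lambda>x. ?g x - p x) = 0"
  have "\<exists>!p. ?Q p"
  proof (rule ex1I[of _ "\<lambda>x. c0 + d0 \<bullet> x"])
    show "?Q (\<lambda>x. c0 + d0 \<bullet> x)"
      using cond P1I by blast
    fix p assume p: "?Q p"
    then obtain c d where pc: "p = (\<lambda>x. c + d \<bullet> x)"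
      by (auto simp: P1_def)
    have "d = d0 \<and> c = c0"
      using p unfolding pc cond by simp
    with pc show "p = (\<lambda>x. c0 + d0 \<bullet> x)"
      by simp
  qed
  from theI'[OF this] show ?thesis
    unfolding Pi_grad_def by blast
qed

lemma L2_on_P1:
  assumes "q \<in> P1" "bounded U" "open U"
  shows "L2_on U q"
proof -
  have q: "continuous_on S q" for S
    using assms(1) by (auto simp: P1_def intro!: continuous_intros)
  have C: "compact (closure U)"
    using assms(2) by (simp add: compact_closure)
  have "L2_on (closure U) q"
    unfolding L2_on_def using C q
    by (auto intro!: continuous_imp_measurable_on_sets_lebesgue integrable_lebesgue_on_compact continuous_intros)
  then show ?thesis
    by (rule L2_on_subset[OF _ closure_subset]) (use assms(3) in auto)
qed

text \<open>The moment condition in \<open>vem_local\<close> makes \<open>Pi_grad E\<close> the orthogonal projection of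
  \<open>L2\<close> onto \<open>P1\<close>, hence a contraction.\<close>

lemma L2_norm_Pi_grad_le:
  assumes E: "polytope E" "interior E \<noteq> {}" and v: "v \<in> vem_local E"
  shows "L2_norm (interior E) (Pi_grad E v) \<le> L2_norm (interior E) v"
    and "L2_on (interior E) (Pi_grad E v)"
proof -
  let ?I = "interior E" and ?p = "Pi_grad E v"
  have cE: "compact E" "convex E"
    using E(1) by (auto simp: polytope_imp_compact polytope_imp_convex)
  have p: "?p \<in> P1"
    by (rule Pi_grad_P1[OF E v])
  show pL2: "L2_on ?I ?p"
    using cE by (intro L2_on_P1 p bounded_interior compact_imp_bounded) auto
  have vL2: "L2_on ?I v"
    using v H1_grad(1)[OF open_interior] by (auto simp: vem_local_def)
  \<comment> \<open>The moment condition is tested with the projected polynomial itself, which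
    \<open>Pi_grad_P1\<close> makes admissible.\<close>
  have "(LINT x|lebesgue_on E. (v x - ?p x) * ?p x) = 0"
    using v p by (simp add: vem_local_def)
  then have "(LINT x|lebesgue_on ?I. v x * ?p x - ?p x * ?p x) = 0"
    by (simp add: integral_interior_convex[OF cE(2,1)] left_diff_distrib)
  then have "(LINT x|lebesgue_on ?I. v x * ?p x) = (LINT x|lebesgue_on ?I. ?p x * ?p x)"
    using L2_on_mult_integrable[OF vL2 pL2] L2_on_mult_integrable[OF pL2 pL2] by simp
  also have "\<dots> = (L2_norm ?I ?p)\<^sup>2"
    unfolding L2_norm_power2 by (simp add: power2_eq_square)
  finally have "(L2_norm ?I ?p)\<^sup>2 \<le> L2_norm ?I v * L2_norm ?I ?p"
    using Cauchy_Schwarz_L2[OF vL2 pL2] by simp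
  then show "L2_norm ?I ?p \<le> L2_norm ?I v"
    using L2_norm_nonneg[of ?I ?p] L2_norm_nonneg[of ?I v]
    by (cases "L2_norm ?I ?p = 0") (auto simp: power2_eq_square)
qed

lemma F_loc_le:
  assumes E: "polytope E" and v: "v \<in> vem_local E" and f: "L2_on (interior E) f"
  shows "F_loc f E v \<le> L2_norm (interior E) f * L2_norm (interior E) v"
proof -
  have cE: "compact E" "convex E"
    using E(1) by (auto simp: polytope_imp_compact polytope_imp_convex)
  have F: "F_loc f E v = (LINT x|lebesgue_on (interior E). f x * Pi_grad E v x)"
    unfolding F_loc_def by (rule integral_interior_convex[OF cE(2,1)])
  show ?thesis
  \<comment> \<open>\<open>Pi_grad_P1\<close> covers only cells with nonempty interior; otherwise
    both sides are 0.\<close>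
  proof (cases "interior E = {}")
    case True
    then show ?thesis
      by (simp add: F L2_norm_def)
  next
    case False
    note p = L2_norm_Pi_grad_le[OF E False v]
    have "F_loc f E v \<le> L2_norm (interior E) f * L2_norm (interior E) (Pi_grad E v)"
      using Cauchy_Schwarz_L2[OF f p(2)] F by simp
    also have "\<dots> \<le> L2_norm (interior E) f * L2_norm (interior E) v"
      by (intro mult_left_mono p L2_norm_nonneg)
    finally show ?thesis .
  qed
qed


section \<open>The trimmed mesh and the stability bound\<close>

text \<open>Inside a hull each piece can be exchanged for a finite set with the same hull. It is
  applied to the vertices in \<open>\<Omega>\<close> and the traces of the frontier on single
  edges.\<close>

lemma polytope_convex_hull_Union:
  assumes "finite \<X>" "\<And>X. X \<in> \<X> \<Longrightarrow> polytope (convex hull X)"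
  shows "polytope (convex hull (\<Union>\<X>))"
  using assms
proof (induction \<X> rule: finite_induct)
  case empty
  show ?case
    using polytope_convex_hull[of "{}"] by simp
next
  case (insert X \<X>)
  then have "polytope (convex hull X)" "polytope (convex hull (\<Union>\<X>))"
    by auto
  then obtain S T where S: "finite S" "convex hull X = convex hull S"
    and T: "finite T" "convex hull (\<Union>\<X>) = convex hull T"
    unfolding polytope_def by blast
  have "convex hull (X \<union> \<Union>\<X>) = convex hull (S \<union> T)"
    using S(2) T(2) hull_Un_left hull_Un_right by metis
  with S(1) T(1) show ?case
    by (simp add: polytope_convex_hull)
qed

lemma cut_cell_subset:
  assumes "polytope K"
  shows "cut_cell \<Omega> K \<subseteq> K"
  unfolding cut_cell_def
proof (rule hull_minimal)
  show "convex K"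
    using assms by (rule polytope_imp_convex)
  show "vertices K \<inter> \<Omega> \<union> frontier \<Omega> \<inter> \<Union>{e \<in> edges K. vertices e \<inter> \<Omega> \<noteq> {}} \<subseteq> K"
    by (auto simp: vertices_def edges_def extreme_point_of_def dest: edge_of_imp_subset)
qed

lemma finite_vertices: "polytope K \<Longrightarrow> finite (vertices K)"
  unfolding vertices_def by (simp add: finite_polyhedron_extreme_points polytope_imp_polyhedron)

text \<open>The boundary of \<open>\<Omega>\<close> may meet an edge in infinitely many points, but the convex hull of a
  compact subset of an edge is a segment.\<close>

lemma polytope_cut_cell:
  assumes "polytope K"
  shows "polytope (cut_cell \<Omega> K)"
proof -
  let ?E = "{e \<in> edges K. vertices e \<inter> \<Omega> \<noteq> {}}"
  have "polytope (convex hull X)" if X: "X \<in> insert (vertices K \<inter> \<Omega>) ((\<lambda>e. frontier \<Omega> \<inter> e) ` ?E)" for X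
  proof (cases "X = {} \<or> X = vertices K \<inter> \<Omega>")
    case True
    then show ?thesis
      using finite_vertices[OF assms] by (auto intro: polytope_convex_hull)
  next
    case False
    with X obtain e where e: "e \<in> edges K" "X = frontier \<Omega> \<inter> e"
      by blast
    then have face: "e face_of K" "aff_dim e = 1"
      by (auto simp: edges_def edge_of_def)
    then have "compact e"
      using assms face_of_imp_compact polytope_imp_compact polytope_imp_convex by blast
    then have "compact (convex hull X)"
      unfolding e(2) by (intro compact_convex_hull closed_Int_compact frontier_closed)
    moreover have "aff_dim (convex hull X) \<le> 1"
      using aff_dim_subset[of X e] e(2) face(2) by (simp add: aff_dim_convex_hull)
    then have "collinear (convex hull X)"
      by (simp add: collinear_aff_dim)
    moreover have "convex hull X \<noteq> {}"
      using False by simp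
    ultimately obtain a b where "convex hull X = closed_segment a b"
      using compact_convex_collinear_segment convex_convex_hull by metis
    then show ?thesis
      by (simp add: segment_convex_hull polytope_convex_hull)
  qed
  moreover have "finite ?E"
    using finite_edges[OF assms] by simp
  ultimately have "polytope (convex hull (\<Union>(insert (vertices K \<inter> \<Omega>) ((\<lambda>e. frontier \<Omega> \<inter> e) ` ?E))))"
    by (intro polytope_convex_hull_Union) auto
  moreover have "\<Union>(insert (vertices K \<inter> \<Omega>) ((\<lambda>e. frontier \<Omega> \<inter> e) ` ?E)) =
      vertices K \<inter> \<Omega> \<union> frontier \<Omega> \<inter> \<Union>?E"
    by auto
  ultimately show ?thesis
    by (simp add: cut_cell_def)
qed

context
  fixes lam h :: real and T :: "pt set set"
  assumes mesh: "background_mesh lam h T"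
begin

lemma trimmed_mesh_polytope: "E \<in> trimmed_mesh \<Omega> T \<Longrightarrow> polytope E"
  using mesh by (auto simp: trimmed_mesh_def active_mesh_def background_mesh_def intro: polytope_cut_cell)

text \<open>By conformity the intersection of two distinct cells is a face of both, and a proper
  face of at least one, whose interior it therefore misses. Trimming only shrinks cells.\<close>

lemma trimmed_mesh_disjoint:
  assumes "E \<in> trimmed_mesh \<Omega> T" "E' \<in> trimmed_mesh \<Omega> T" "E \<noteq> E'"
  shows "interior E \<inter> interior E' = {}"
proof -
  obtain K K' where K: "K \<in> T" "K' \<in> T" and E: "E = cut_cell \<Omega> K" "E' = cut_cell \<Omega> K'"
    using assms(1,2) by (auto simp: trimmed_mesh_def active_mesh_def)
  have sub: "E \<subseteq> K" "E' \<subseteq> K'"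
    using K mesh E cut_cell_subset by (auto simp: background_mesh_def)
  have face: "(K \<inter> K') face_of K" "(K \<inter> K') face_of K'"
    using K mesh by (auto simp: background_mesh_def)
  have "K \<noteq> K'"
    using assms(3) E by blast
  then have "K \<inter> K' \<inter> interior K = {} \<or> K \<inter> K' \<inter> interior K' = {}"
    using face_of_disjoint_interior[OF face(1)] face_of_disjoint_interior[OF face(2)] by blast
  then show ?thesis
    using interior_mono[OF sub(1)] interior_mono[OF sub(2)] interior_subset[of K] interior_subset[of K']
    by blast
qed

text \<open>A segment from a vertex in \<open>\<Omega>\<close> to a point outside \<open>\<Omega>t\<close> crosses both boundaries, and its
  part inside \<open>\<Omega>\<close> has positive length, so it is longer than the diameter of a cell.\<close>

lemma trimmed_mesh_subset:
  assumes \<Omega>: "open \<Omega>" "closure \<Omega> \<subseteq> \<Omega>t" and \<Omega>t: "open \<Omega>t"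
    and d: "\<delta> \<le> setdist (frontier \<Omega>) (frontier \<Omega>t)" "0 < lam" "h \<le> lam * \<delta>"
    and E: "E \<in> trimmed_mesh \<Omega> T"
  shows "E \<subseteq> \<Omega>t"
proof -
  obtain K where K: "K \<in> active_mesh \<Omega> T" and EK: "E = cut_cell \<Omega> K"
    using E by (auto simp: trimmed_mesh_def)
  then have KT: "polytope K" "diameter K \<le> h / lam"
    using mesh by (auto simp: active_mesh_def background_mesh_def)
  obtain x where x: "x \<in> K" "x \<in> \<Omega>"
    using K by (auto simp: active_mesh_def vertices_def extreme_point_of_def)
  have "y \<in> \<Omega>t" if y: "y \<in> K" for y
  proof (rule ccontr)
    assume "y \<notin> \<Omega>t"
    moreover have "x \<in> \<Omega>t"
      using x(2) \<Omega>(2) closure_subset by blast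
    ultimately obtain z2 where z2: "z2 \<in> closed_segment x y" "z2 \<in> frontier \<Omega>t"
      using connected_Int_frontier[of "closed_segment x y" \<Omega>t] by auto
    then have "z2 \<notin> \<Omega>"
      using \<Omega>(2) \<Omega>t closure_subset by (auto simp: frontier_def interior_open)
    with x(2) obtain z1 where z1: "z1 \<in> closed_segment x z2" "z1 \<in> frontier \<Omega>"
      using connected_Int_frontier[of "closed_segment x z2" \<Omega>] by auto
    \<comment> \<open>This supplies the strict inequality: the distance of the two frontiers and the
      diameter of a cell are only compared by \<open>\<le>\<close>.\<close>
    have "x \<noteq> z1"
      using z1(2) x(2) \<Omega>(1) by (auto simp: frontier_def interior_open)
    moreover have "dist x y = dist x z2 + dist z2 y" "dist x z2 = dist x z1 + dist z1 z2"
      using z1(1) z2(1) by (simp_all add: between between_mem_segment[symmetric])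
    moreover have "\<delta> \<le> dist z1 z2"
      using d(1) setdist_le_dist[OF z1(2) z2(2)] by simp
    moreover have "dist x y \<le> diameter K"
      using KT(1) x(1) y by (intro diameter_bounded_bound polytope_imp_bounded)
    moreover have "h / lam \<le> \<delta>"
      using d(2,3) by (simp add: divide_le_eq mult.commute)
    ultimately show False
      using KT(2) zero_le_dist[of z2 y] zero_less_dist_iff[of x z1] by linarith
  qed
  then show ?thesis
    using EK cut_cell_subset[OF KT(1)] by blast
qed

end

text \<open>By disjointness at most one indicator in the sum is nonzero at each point, so the summed
  integrand stays below the integrand on \<open>U\<close>.\<close>

lemma sum_L2_norm_disjoint_le:
  assumes "finite M" "\<And>E. E \<in> M \<Longrightarrow> E \<subseteq> U" "\<And>E. E \<in> M \<Longrightarrow> E \<in> sets lebesgue"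
    and disj: "\<And>E E'. E \<in> M \<Longrightarrow> E' \<in> M \<Longrightarrow> E \<noteq> E' \<Longrightarrow> E \<inter> E' = {}"
    and U: "U \<in> sets lebesgue" and w: "L2_on U w"
  shows "(\<Sum>E\<in>M. (L2_norm E w)\<^sup>2) \<le> (L2_norm U w)\<^sup>2"
proof -
  let ?n = "\<lambda>x. (norm (w x))\<^sup>2"
  have int: "integrable lebesgue (\<lambda>x. indicator E x *\<^sub>R ?n x)" if "E \<in> M" for E
    using L2_on_subset[OF w assms(2)[OF that] U assms(3)[OF that]] assms(3)[OF that]
    by (simp add: L2_on_def integrable_restrict_space)
  have "(\<Sum>E\<in>M. (L2_norm E w)\<^sup>2) = (\<Sum>E\<in>M. LINT x|lebesgue. indicator E x *\<^sub>R ?n x)"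
    using assms(3) by (simp add: L2_norm_power2 integral_restrict_space)
  also have "\<dots> = (LINT x|lebesgue. (\<Sum>E\<in>M. indicator E x *\<^sub>R ?n x))"
    by (rule Bochner_Integration.integral_sum[symmetric]) (rule int)
  also have "\<dots> \<le> (LINT x|lebesgue. indicator U x *\<^sub>R ?n x)"
  proof (rule integral_mono)
    show "integrable lebesgue (\<lambda>x. \<Sum>E\<in>M. indicator E x *\<^sub>R ?n x)"
      by (rule Bochner_Integration.integrable_sum) (rule int)
    show "integrable lebesgue (\<lambda>x. indicator U x *\<^sub>R ?n x)"
      using w U by (simp add: L2_on_def integrable_restrict_space)
    fix x
    show "(\<Sum>E\<in>M. indicator E x *\<^sub>R ?n x) \<le> indicator U x *\<^sub>R ?n x"
    proof (cases "\<exists>E0\<in>M. x \<in> E0")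
      case True
      then obtain E0 where E0: "E0 \<in> M" "x \<in> E0" by blast
      then have "(\<Sum>E\<in>M - {E0}. indicator E x *\<^sub>R ?n x) = 0"
        using disj by (intro sum.neutral) (fastforce simp: indicator_def)
      then have "(\<Sum>E\<in>M. indicator E x *\<^sub>R ?n x) = indicator E0 x *\<^sub>R ?n x"
        using sum.remove[OF assms(1) E0(1), of "\<lambda>E. indicator E x *\<^sub>R ?n x"] by simp
      then show ?thesis
        using E0 assms(2)[OF E0(1)] by (auto simp: indicator_def)
    next
      case False
      then have "(\<Sum>E\<in>M. indicator E x *\<^sub>R ?n x) = 0"
        by (intro sum.neutral) (auto simp: indicator_def)
      then show ?thesis by (simp add: indicator_def)
    qed
  qed
  also have "\<dots> = (L2_norm U w)\<^sup>2"
    using U by (simp add: L2_norm_power2 integral_restrict_space)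
  finally show ?thesis .
qed

text \<open>The bounds on the cells are combined by the discrete Cauchy-Schwarz inequality;
  disjointness of the interiors then bounds the two sums of squares by the global norms.\<close>

lemma F_form_le:
  assumes "finite M" and M: "\<And>E. E \<in> M \<Longrightarrow> polytope E" "\<And>E. E \<in> M \<Longrightarrow> interior E \<subseteq> U"
    and disj: "\<And>E E'. E \<in> M \<Longrightarrow> E' \<in> M \<Longrightarrow> E \<noteq> E' \<Longrightarrow> interior E \<inter> interior E' = {}"
    and U: "open U" and f: "L2_on U f"
    and v: "\<And>E. E \<in> M \<Longrightarrow> v \<in> vem_local E" "L2_on (mesh_domain M) v"
  shows "F_form f M v \<le> L2_norm U f * L2_norm (mesh_domain M) v"
proof -
  have sub: "interior E \<subseteq> mesh_domain M" if "E \<in> M" for E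
    unfolding mesh_domain_def using that by (intro interior_mono) blast
  have sums: "(\<Sum>E\<in>M. (L2_norm (interior E) w)\<^sup>2) \<le> (L2_norm V w)\<^sup>2"
    if w: "L2_on V w" "open V" "\<And>E. E \<in> M \<Longrightarrow> interior E \<subseteq> V" for V and w :: "pt \<Rightarrow> real"
  proof -
    \<comment> \<open>Without the cells of empty interior, \<open>interior\<close> is injective on
      the mesh, so the sum can be indexed by disjoint sets.\<close>
    have "(\<Sum>E\<in>M. (L2_norm (interior E) w)\<^sup>2) = (\<Sum>E\<in>{E \<in> M. interior E \<noteq> {}}. (L2_norm (interior E) w)\<^sup>2)"
      using assms(1) by (intro sum.mono_neutral_right) (auto simp: L2_norm_def)
    also have "\<dots> = (\<Sum>I\<in>interior ` {E \<in> M. interior E \<noteq> {}}. (L2_norm I w)\<^sup>2)"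
      using disj by (intro sum.reindex[symmetric, unfolded o_def]) (fastforce simp: inj_on_def)
    also have "\<dots> \<le> (L2_norm V w)\<^sup>2"
    proof (rule sum_L2_norm_disjoint_le)
      show "I \<inter> I' = {}" if "I \<in> interior ` {E \<in> M. interior E \<noteq> {}}"
        "I' \<in> interior ` {E \<in> M. interior E \<noteq> {}}" "I \<noteq> I'" for I I'
        using that disj by blast
    qed (use assms(1) w in auto)
    finally show ?thesis .
  qed
  \<comment> \<open>The absolute values, harmless for norms, match the form of
    \<open>L2_set_mult_ineq\<close>.\<close>
  have "F_form f M v \<le> (\<Sum>E\<in>M. \<bar>L2_norm (interior E) f\<bar> * \<bar>L2_norm (interior E) v\<bar>)"
    unfolding F_form_def
  proof (rule sum_mono)
    fix E assume E: "E \<in> M"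
    have "L2_on (interior E) f"
      using L2_on_subset[OF f M(2)[OF E]] U by simp
    then show "F_loc f E v \<le> \<bar>L2_norm (interior E) f\<bar> * \<bar>L2_norm (interior E) v\<bar>"
      using F_loc_le[OF M(1)[OF E] v(1)[OF E]] by (simp add: L2_norm_nonneg)
  qed
  also have "\<dots> \<le> L2_set (\<lambda>E. L2_norm (interior E) f) M * L2_set (\<lambda>E. L2_norm (interior E) v) M"
    by (rule L2_set_mult_ineq)
  also have "\<dots> \<le> L2_norm U f * L2_norm (mesh_domain M) v"
  proof (rule mult_mono)
    show "L2_set (\<lambda>E. L2_norm (interior E) f) M \<le> L2_norm U f"
      unfolding L2_set_def using sums[OF f U M(2)] by (simp add: L2_norm_nonneg real_le_lsqrt)
    show "L2_set (\<lambda>E. L2_norm (interior E) v) M \<le> L2_norm (mesh_domain M) v"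
      unfolding L2_set_def using sums[OF v(2) _ sub]
      by (simp add: L2_norm_nonneg real_le_lsqrt mesh_domain_def)
  qed (simp_all add: L2_norm_nonneg)
  finally show ?thesis .
qed

lemma c_loc_nonneg:
  assumes "AE x in lebesgue_on U. \<sigma> x - divb x / 2 \<ge> 0" "E \<subseteq> U" "E \<in> sets lebesgue" "U \<in> sets lebesgue"
  shows "0 \<le> c_loc \<sigma> divb E u u"
proof -
  have "AE x in lebesgue. x \<in> U \<longrightarrow> \<sigma> x - divb x / 2 \<ge> 0"
    using assms(1,4) by (simp add: AE_restrict_space_iff)
  then have "AE x in lebesgue. x \<in> E \<longrightarrow> (\<sigma> x - divb x / 2) * Pi_grad E u x * Pi_grad E u x \<ge> 0"
  proof (rule AE_mp, intro AE_I2 impI)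
    fix x assume "x \<in> U \<longrightarrow> \<sigma> x - divb x / 2 \<ge> 0" "x \<in> E"
    with assms(2) have "\<sigma> x - divb x / 2 \<ge> 0" by blast
    then show "(\<sigma> x - divb x / 2) * Pi_grad E u x * Pi_grad E u x \<ge> 0"
      unfolding mult.assoc by (rule mult_nonneg_nonneg) simp
  qed
  then have "AE x in lebesgue_on E. (\<sigma> x - divb x / 2) * Pi_grad E u x * Pi_grad E u x \<ge> 0"
    using assms(3) by (simp add: AE_restrict_space_iff)
  then show ?thesis
    unfolding c_loc_def by (rule integral_nonneg_AE)
qed

text \<open>For equal arguments the two halves of \<open>b_loc\<close> are literally the same
  integral and cancel.\<close>

lemma a_form_le_B_form:
  assumes "\<And>E. E \<in> M \<Longrightarrow> 0 \<le> c_loc \<sigma> divb E u u"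
  shows "a_form \<mu> P s M u u \<le> B_form \<mu> b divb \<sigma> P s M u u"
  unfolding a_form_def B_form_def b_loc_def using assms by (intro sum_mono) auto

theorem proposition4p1:
  fixes \<Omega> \<Omega>t :: "pt set"
    and A :: "(real \<times> (real \<Rightarrow> pt)) set"
    and \<mu> \<sigma> f divb :: "pt \<Rightarrow> real"
    and b :: "pt \<Rightarrow> pt"
    and \<delta>0 \<mu>0 lam h0 R cs Cs C\<Pi> \<mu>star CP :: real
    and H :: "real set"
    and T :: "real \<Rightarrow> pt set set"
    and S1 :: "real \<Rightarrow> pt set \<Rightarrow> (pt \<Rightarrow> real) set"
    and P :: "real \<Rightarrow> pt set \<Rightarrow> (pt \<Rightarrow> real) \<Rightarrow> pt \<Rightarrow> real"
    and s :: "real \<Rightarrow> pt set \<Rightarrow> (pt \<Rightarrow> real) \<Rightarrow> (pt \<Rightarrow> real) \<Rightarrow> real"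
  assumes Omega: "planar_domain \<Omega>" "bounded \<Omega>" "lipschitz_boundary \<Omega>" "piecewise_C2_boundary \<Omega> A"
    and Omegat: "planar_domain \<Omega>t" "bounded \<Omega>t" "closure \<Omega> \<subseteq> \<Omega>t"
    and delta0: "\<delta>0 > 0" "\<delta>0 \<le> setdist (frontier \<Omega>) (frontier \<Omega>t)"
    and data: "admissible_data \<Omega>t \<mu> b divb \<sigma> f \<mu>0"
    and lam: "0 < lam" "lam < 1"
    and h0: "0 < h0" "h0 \<le> lam * \<delta>0"
    and H: "H \<subseteq> {0<..h0}"
    and mesh: "\<And>h. h \<in> H \<Longrightarrow> background_mesh lam h (T h)"
    and R: "R > 1"
    and breaks: "\<And>h K. h \<in> H \<Longrightarrow> K \<in> active_mesh \<Omega> (T h) \<Longrightarrow>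
        card (break_points A \<inter> {x. infdist x K < R * h}) \<le> 1"
    and proj: "\<And>h E. h \<in> H \<Longrightarrow> E \<in> trimmed_mesh \<Omega> (T h) \<Longrightarrow>
        admissible_projection E (S1 h E) (P h E) C\<Pi>"
    and cs: "0 < cs" "cs \<le> Cs"
    and stab: "\<And>h E. h \<in> H \<Longrightarrow> E \<in> trimmed_mesh \<Omega> (T h) \<Longrightarrow>
        admissible_stabilization E (P h E) (s h E) cs Cs"
    and mustar: "\<mu>star > 0"
        "\<And>h v. h \<in> H \<Longrightarrow> v \<in> vem_space (trimmed_mesh \<Omega> (T h)) \<Longrightarrow>
           \<mu>star * (H1_semi (mesh_domain (trimmed_mesh \<Omega> (T h))) v)\<^sup>2
             \<le> a_form \<mu> (P h) (s h) (trimmed_mesh \<Omega> (T h)) v v"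
    and CP: "poincare_const \<Omega>t CP"
  shows "\<forall>h\<in>H. \<forall>uh\<in>vem_space (trimmed_mesh \<Omega> (T h)).
      (\<forall>vh\<in>vem_space (trimmed_mesh \<Omega> (T h)).
         B_form \<mu> b divb \<sigma> (P h) (s h) (trimmed_mesh \<Omega> (T h)) uh vh
           = F_form f (trimmed_mesh \<Omega> (T h)) vh)
      \<longrightarrow> H1_semi (mesh_domain (trimmed_mesh \<Omega> (T h))) uh \<le> CP / \<mu>star * L2_norm \<Omega>t f"
proof (intro ballI impI)
  fix h uh
  let ?M = "trimmed_mesh \<Omega> (T h)"
  let ?D = "mesh_domain ?M"
  assume h: "h \<in> H" and uh: "uh \<in> vem_space ?M"
    and sol: "\<forall>vh\<in>vem_space ?M. B_form \<mu> b divb \<sigma> (P h) (s h) ?M uh vh = F_form f ?M vh"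
  note mesh_h = mesh[OF h]
  have opens: "open \<Omega>" "open \<Omega>t" "open ?D"
    using Omega(1) Omegat(1) by (auto simp: planar_domain_def mesh_domain_def)
  \<comment> \<open>This containment is used three times: for Poincare's inequality, for the sign of
    the reaction term, and for bounding \<open>f\<close> on the cells by its norm on
    \<open>\<Omega>t\<close>.\<close>
  have E_sub: "E \<subseteq> \<Omega>t" if "E \<in> ?M" for E
  proof (rule trimmed_mesh_subset[OF mesh_h opens(1) Omegat(3) opens(2) delta0(2) lam(1) _ that])
    show "h \<le> lam * \<delta>0"
      using h H h0(2) by auto
  qed
  have "?D \<subseteq> \<Omega>t"
    unfolding mesh_domain_def using E_sub interior_subset by blast
  moreover have u10: "uh \<in> H10 ?D" and uloc: "\<And>E. E \<in> ?M \<Longrightarrow> uh \<in> vem_local E"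
    using uh by (auto simp: vem_space_def)
  ultimately have poincare: "L2_norm ?D uh \<le> CP * H1_semi ?D uh"
    using poincare_subdomain[OF opens(3,2) _ CP] by blast
  have CP0: "CP > 0"
    using CP by (simp add: poincare_const_def)
  have fL2: "L2_on \<Omega>t f" and reac: "AE x in lebesgue_on \<Omega>t. \<sigma> x - divb x / 2 \<ge> 0"
    using data by (auto simp: admissible_data_def)
  have semi: "0 \<le> H1_semi ?D uh"
    by (simp add: H1_semi_def L2_norm_nonneg)
  have c: "0 \<le> c_loc \<sigma> divb E uh uh" if "E \<in> ?M" for E
    using E_sub[OF that] polytope_imp_compact[OF trimmed_mesh_polytope[OF mesh_h that]] opens(2)
    by (intro c_loc_nonneg[OF reac]) (auto simp: borel_compact)
  have "\<mu>star * (H1_semi ?D uh)\<^sup>2 \<le> a_form \<mu> (P h) (s h) ?M uh uh"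
    by (rule mustar(2)[OF h uh])
  also have "\<dots> \<le> B_form \<mu> b divb \<sigma> (P h) (s h) ?M uh uh"
    by (rule a_form_le_B_form[OF c])
  also have "\<dots> = F_form f ?M uh"
    using sol uh by blast
  also have "\<dots> \<le> L2_norm \<Omega>t f * L2_norm ?D uh"
  proof (cases "finite ?M")
    case True
    have "L2_on ?D uh"
      using u10 H1_grad(1)[OF opens(3)] by (simp add: H10_def)
    with True show ?thesis
      using E_sub interior_subset
      by (intro F_form_le[OF True trimmed_mesh_polytope[OF mesh_h] _ trimmed_mesh_disjoint[OF mesh_h]
            opens(2) fL2 uloc]) blast+
  next
    case False
    then show ?thesis
      by (simp add: F_form_def L2_norm_nonneg)
  qed
  also have "\<dots> \<le> L2_norm \<Omega>t f * (CP * H1_semi ?D uh)"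
    by (intro mult_left_mono poincare L2_norm_nonneg)
  finally have main: "\<mu>star * H1_semi ?D uh * H1_semi ?D uh \<le> CP * L2_norm \<Omega>t f * H1_semi ?D uh"
    by (simp add: power2_eq_square mult_ac)
  show "H1_semi ?D uh \<le> CP / \<mu>star * L2_norm \<Omega>t f"
  \<comment> \<open>One factor of the seminorm cancels in \<open>main\<close>; if it is 0, the claim
    only says that the right-hand side is nonnegative.\<close>
  proof (cases "H1_semi ?D uh = 0")
    case True
    then show ?thesis
      using CP0 mustar(1) by (simp add: L2_norm_nonneg)
  next
    case False
    with semi main have "\<mu>star * H1_semi ?D uh \<le> CP * L2_norm \<Omega>t f"
      by simp
    then show ?thesis
      using mustar(1) by (simp add: field_simps)
  qed
qed

end
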